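(* Let $\phi=\tilde p/p$ be an irreducible rational inner function on $\mathbb{D}^3$ of degree $(m,n,1)$, with $p(z)=p_1(z_1,z_2)+z_3p_2(z_1,z_2)$, $\tilde p(z)=z_3\tilde p_1(z_1,z_2)+\tilde p_2(z_1,z_2)$, and assume $\mathcal{Z}_{\tilde p}\cap\mathbb{T}^3$ contains no vertical line $\{(\zeta_1,\zeta_2)\}\times\mathbb{T}$. Assume $\phi$ has a singularity at $(1,1,1)$, i.e. $(1,1,1)\in\mathcal{Z}_p$. Let $\rho(\theta_1,\theta_2)=1-|\psi^0(e^{i\theta_1},e^{i\theta_2})|^2$ with $\psi^0=-\tilde p_2/\tilde p_1$, and let $c_{2,0},c_{1,1},c_{0,2}$ be the coefficients of $\theta_1^2,\theta_1\theta_2,\theta_2^2$ in the Taylor expansion of $\rho$ at $(0,0)$ (so $c_{2,0}c_{0,2}\ge0$). Then: (a) if $c_{1,1}\ne\pm2\sqrt{c_{0,2}c_{2,0}}$, there is a neighborhood $V\subseteq\mathbb{T}^2$ of $(1,1)$ such that $\frac{\partial\phi}{\partial z_3}\in L^{\mathfrak{p}}(V\times\mathbb{T})$ if and only if $\mathfrak{p}<2$; (b) if $c_{1,1}=\pm2\sqrt{c_{0,2}c_{2,0}}$, there are a neighborhood $V\subseteq\mathbb{T}^2$ of $(1,1)$ and some $\mathfrak{p}<2$ such that $\frac{\partial\phi}{\partial z_3}\notin L^{\mathfrak{p}}(V\times\mathbb{T})$.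
   Context: A rational inner function (RIF) on $\mathbb{D}^3$ is a rational function holomorphic on the tridisk with unimodular radial limits a.e. on $\mathbb{T}^3$; it is written $\phi=\tilde p/p$ with $p$ zero-free on $\mathbb{D}^3$, $p,\tilde p$ without common factors. For degree $(m,n,1)$, $\tilde p(z)=z_1^mz_2^nz_3\overline{p(1/\bar z_1,1/\bar z_2,1/\bar z_3)}$ and $\tilde p_j(z_1,z_2)=z_1^mz_2^n\overline{p_j(1/\bar z_1,1/\bar z_2)}$. Under the no-vertical-line assumption $\tilde p_1$ has no zeros on $\mathbb{T}^2$, so $\rho$ is real analytic. $L^{\mathfrak{p}}$ is with respect to Lebesgue (arc-length) measure and $1\le \mathfrak{p}<\infty$. *)

theory Defs
  imports "HOL-Analysis.Analysis"
begin

type_synonym c3 = "complex \<times> complex \<times> complex"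

abbreviation circ :: "complex set" where "circ \<equiv> sphere 0 1"
abbreviation disc :: "complex set" where "disc \<equiv> ball 0 1"

definition P :: "(nat \<Rightarrow> nat \<Rightarrow> nat \<Rightarrow> complex) \<Rightarrow> nat \<Rightarrow> nat \<Rightarrow> c3 \<Rightarrow> complex" where
  "P a m n z = (case z of (z1, z2, z3) \<Rightarrow>
     (\<Sum>i\<le>m. \<Sum>j\<le>n. \<Sum>k\<le>1. a i j k * z1 ^ i * z2 ^ j * z3 ^ k))"

text \<open>Reflection: z1^m z2^n z3 conj(p(1/conj z)), written out on coefficients.\<close>
definition Ptil :: "(nat \<Rightarrow> nat \<Rightarrow> nat \<Rightarrow> complex) \<Rightarrow> nat \<Rightarrow> nat \<Rightarrow> c3 \<Rightarrow> complex" where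
  "Ptil a m n z = (case z of (z1, z2, z3) \<Rightarrow>
     (\<Sum>i\<le>m. \<Sum>j\<le>n. \<Sum>k\<le>1. cnj (a i j k) * z1 ^ (m - i) * z2 ^ (n - j) * z3 ^ (1 - k)))"

text \<open>p = p_1 + z3 p_2 and ptil = z3 ptil_1 + ptil_2, ptil_j the (m,n)-reflection of p_j.\<close>
definition Ptil1 :: "(nat \<Rightarrow> nat \<Rightarrow> nat \<Rightarrow> complex) \<Rightarrow> nat \<Rightarrow> nat \<Rightarrow> complex \<Rightarrow> complex \<Rightarrow> complex" where
  "Ptil1 a m n z1 z2 = (\<Sum>i\<le>m. \<Sum>j\<le>n. cnj (a i j 0) * z1 ^ (m - i) * z2 ^ (n - j))"

definition Ptil2 :: "(nat \<Rightarrow> nat \<Rightarrow> nat \<Rightarrow> complex) \<Rightarrow> nat \<Rightarrow> nat \<Rightarrow> complex \<Rightarrow> complex \<Rightarrow> complex" where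
  "Ptil2 a m n z1 z2 = (\<Sum>i\<le>m. \<Sum>j\<le>n. cnj (a i j 1) * z1 ^ (m - i) * z2 ^ (n - j))"

text \<open>Polynomial functions on C^3 (over C these are the same as polynomials).\<close>
definition is_poly3 :: "(c3 \<Rightarrow> complex) \<Rightarrow> bool" where
  "is_poly3 f \<longleftrightarrow> (\<exists>N c. \<forall>z1 z2 z3. f (z1, z2, z3) =
      (\<Sum>i\<le>N. \<Sum>j\<le>N. \<Sum>k\<le>N. c i j k * z1 ^ i * z2 ^ j * z3 ^ k))"

definition const3 :: "(c3 \<Rightarrow> complex) \<Rightarrow> bool" where
  "const3 f \<longleftrightarrow> (\<exists>c. \<forall>z. f z = c)"

definition irreducible3 :: "(c3 \<Rightarrow> complex) \<Rightarrow> bool" where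
  "irreducible3 f \<longleftrightarrow> is_poly3 f \<and> \<not> const3 f \<and>
     (\<forall>q r. is_poly3 q \<longrightarrow> is_poly3 r \<longrightarrow> (\<forall>z. f z = q z * r z) \<longrightarrow> const3 q \<or> const3 r)"

definition poly_dvd3 :: "(c3 \<Rightarrow> complex) \<Rightarrow> (c3 \<Rightarrow> complex) \<Rightarrow> bool" where
  "poly_dvd3 q f \<longleftrightarrow> (\<exists>r. is_poly3 r \<and> (\<forall>z. f z = q z * r z))"

definition no_common_factor3 :: "(c3 \<Rightarrow> complex) \<Rightarrow> (c3 \<Rightarrow> complex) \<Rightarrow> bool" where
  "no_common_factor3 f g \<longleftrightarrow>
     \<not> (\<exists>q. is_poly3 q \<and> \<not> const3 q \<and> poly_dvd3 q f \<and> poly_dvd3 q g)"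

definition has_degree :: "(nat \<Rightarrow> nat \<Rightarrow> nat \<Rightarrow> complex) \<Rightarrow> nat \<Rightarrow> nat \<Rightarrow> bool" where
  "has_degree a m n \<longleftrightarrow>
     (\<forall>i j k. (m < i \<or> n < j \<or> 1 < k) \<longrightarrow> a i j k = 0) \<and>
     (\<exists>j\<le>n. \<exists>k\<le>1. a m j k \<noteq> 0) \<and>
     (\<exists>i\<le>m. \<exists>k\<le>1. a i n k \<noteq> 0) \<and>
     (\<exists>i\<le>m. \<exists>j\<le>n. a i j 1 \<noteq> 0)"

definition phi :: "(nat \<Rightarrow> nat \<Rightarrow> nat \<Rightarrow> complex) \<Rightarrow> nat \<Rightarrow> nat \<Rightarrow> c3 \<Rightarrow> complex" where
  "phi a m n z = Ptil a m n z / P a m n z"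

definition RIF :: "(nat \<Rightarrow> nat \<Rightarrow> nat \<Rightarrow> complex) \<Rightarrow> nat \<Rightarrow> nat \<Rightarrow> bool" where
  "RIF a m n \<longleftrightarrow>
     (\<forall>z1\<in>disc. \<forall>z2\<in>disc. \<forall>z3\<in>disc. P a m n (z1, z2, z3) \<noteq> 0) \<and>
     no_common_factor3 (P a m n) (Ptil a m n) \<and>
     (AE t in lborel. \<exists>L. cmod L = 1 \<and>
        ((\<lambda>r. phi a m n (of_real r * cis (fst t), of_real r * cis (fst (snd t)),
                            of_real r * cis (snd (snd t)))) \<longlongrightarrow> L) (at_left 1))"

definition dphi3 :: "(nat \<Rightarrow> nat \<Rightarrow> nat \<Rightarrow> complex) \<Rightarrow> nat \<Rightarrow> nat \<Rightarrow> c3 \<Rightarrow> complex" where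
  "dphi3 a m n z = (case z of (z1, z2, z3) \<Rightarrow> deriv (\<lambda>w. phi a m n (z1, z2, w)) z3)"

definition rho :: "(nat \<Rightarrow> nat \<Rightarrow> nat \<Rightarrow> complex) \<Rightarrow> nat \<Rightarrow> nat \<Rightarrow> real \<Rightarrow> real \<Rightarrow> real" where
  "rho a m n t1 t2 = 1 - (cmod (- Ptil2 a m n (cis t1) (cis t2) / Ptil1 a m n (cis t1) (cis t2)))\<^sup>2"

definition c20 where "c20 a m n = deriv (deriv (\<lambda>t. rho a m n t 0)) 0 / 2"
definition c02 where "c02 a m n = deriv (deriv (\<lambda>t. rho a m n 0 t)) 0 / 2"
definition c11 where "c11 a m n = deriv (\<lambda>s. deriv (\<lambda>t. rho a m n t s) 0) 0"

definition nbhd_T2 :: "(complex \<times> complex) set \<Rightarrow> bool" where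
  "nbhd_T2 V \<longleftrightarrow> V \<subseteq> circ \<times> circ \<and>
     (\<exists>U. openin (top_of_set (circ \<times> circ)) U \<and> (1, 1) \<in> U \<and> U \<subseteq> V)"

definition angles :: "(complex \<times> complex) set \<Rightarrow> (real \<times> real \<times> real) set" where
  "angles V = {t. fst t \<in> {-pi<..pi} \<and> fst (snd t) \<in> {-pi<..pi} \<and> snd (snd t) \<in> {-pi<..pi}
                 \<and> (cis (fst t), cis (fst (snd t))) \<in> V}"

definition in_Lp :: "real \<Rightarrow> (c3 \<Rightarrow> complex) \<Rightarrow> (complex \<times> complex) set \<Rightarrow> bool" where
  "in_Lp q f V \<longleftrightarrow>
     (let g = (\<lambda>t. f (cis (fst t), cis (fst (snd t)), cis (snd (snd t)))) in
       g \<in> borel_measurable (lebesgue_on (angles V)) \<and>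
       (\<integral>\<^sup>+ t. ennreal (cmod (g t) powr q) \<partial>(lebesgue_on (angles V))) < \<infinity>)"

end

theory Submission
  imports Defs "HOL-Computational_Algebra.Polynomial_Factorial"
    "HOL-Computational_Algebra.Field_as_Ring"
begin

text \<open>On the torus \<open>|\<partial>\<phi>/\<partial>z\<^sub>3|\<close> is the Poisson kernel \<open>\<rho> / |1 + z\<^sub>3 w|\<^sup>2\<close> with
  \<open>w = p\<^sub>2/p\<^sub>1\<close> and \<open>\<rho> = 1 - |w|\<^sup>2\<close>, whose \<open>q\<close>-th power has integral comparable to \<open>\<rho>\<^bsup>1-q\<^esup>\<close> in
  \<open>z\<^sub>3\<close>. Since \<open>\<rho> \<ge> 0\<close> vanishes at the singularity, its Taylor expansion starts with a nonnegative
  quadratic form. If the form is definite, \<open>\<integral> \<rho>\<^bsup>1-q\<^esup>\<close> behaves like \<open>\<integral> |\<theta>|\<^bsup>2-2q\<^esup>\<close>, finite exactly for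
  \<open>q < 2\<close>. If it is degenerate, \<open>\<rho> = O(s\<^sup>3)\<close> on a cusp of width \<open>s\<^bsup>3/2\<^esup>\<close> along its null line, so the
  integral diverges already for \<open>q = 11/6\<close>. The set \<open>\<rho> = 0\<close>, where the lower bounds fail, is null: it
  is the zero set of \<open>p\<^sub>1 p\<^sub>1\<^sup>~ - p\<^sub>2 p\<^sub>2\<^sup>~\<close>, and if that polynomial were zero, coprimality of \<open>p\<^sub>1, p\<^sub>2\<close>
  would make \<open>p\<close> divide its reflection.\<close>

subsection \<open>Bivariate polynomials on the torus\<close>

text \<open>The exponent 11/6 comes from a balance. At distance s^(3/2) from the null line the
  quadratic form is of order s^3, the size of the Taylor remainder. A slice of the cusp at height s
  then contributes s^(3(1-q) + 3/2), and the integral of this diverges at 0 exactly when q \<ge>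
  11/6. Irreducibility and common factors are stated for polynomial functions, while the
  divisibility argument needs a factorial ring. Hence bivariate polynomials are elements of
  \<open>complex poly poly\<close>, z2 being the outer and z1 the inner variable, and
  \<open>ev\<close> turns them into functions. The null set \<rho> = 0 matters twice because of
  conventions of HOL: \<open>deriv\<close> has no usable value at zeros of p, and
  \<open>0 powr (1 - q)\<close> is 0 instead of infinite. Measurability and the lower bounds
  therefore rest on almost-everywhere statements. Convergence is local, since \<rho> may vanish
  elsewhere on the torus; both divergence results hold for every box around (1,1).\<close>

definition ev :: "complex poly poly \<Rightarrow> complex \<Rightarrow> complex \<Rightarrow> complex" where
  "ev X z1 z2 = poly (poly X [:z2:]) z1"

lemma ev_simps [simp]:
  "ev (X + Y) z1 z2 = ev X z1 z2 + ev Y z1 z2"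
  "ev (X - Y) z1 z2 = ev X z1 z2 - ev Y z1 z2"
  "ev (X * Y) z1 z2 = ev X z1 z2 * ev Y z1 z2"
  "ev 0 z1 z2 = 0"
  by (simp_all add: ev_def)

lemma ev_altdef:
  assumes "degree X \<le> N" and "\<And>j. degree (coeff X j) \<le> N"
  shows "ev X z1 z2 = (\<Sum>i\<le>N. \<Sum>j\<le>N. coeff (coeff X j) i * z1 ^ i * z2 ^ j)"
proof -
  have 1: "poly p x = (\<Sum>i\<le>N. coeff p i * x ^ i)" if "degree p \<le> N" for p :: "'a::comm_ring_1 poly" and x
    unfolding poly_altdef using that
    by (intro sum.mono_neutral_left) (auto simp: coeff_eq_0)
  have "ev X z1 z2 = (\<Sum>j\<le>N. poly (coeff X j) z1 * z2 ^ j)"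
    by (simp add: ev_def 1[OF assms(1)] poly_sum)
  also have "\<dots> = (\<Sum>j\<le>N. \<Sum>i\<le>N. coeff (coeff X j) i * z1 ^ i * z2 ^ j)"
    by (simp add: 1[OF assms(2)] sum_distrib_right)
  finally show ?thesis by (subst sum.swap)
qed

text \<open>\<open>is_poly3\<close> bounds all exponents by a single N, so the outer degree and all
  inner degrees need a common bound.\<close>

lemma degree_bound_poly_poly:
  fixes X :: "'a::zero poly poly"
  obtains N where "degree X \<le> N" "\<And>j. degree (coeff X j) \<le> N"
proof
  let ?N = "degree X + (\<Sum>j\<le>degree X. degree (coeff X j))"
  show "degree X \<le> ?N" by simp
  show "degree (coeff X j) \<le> ?N" for j
  proof (cases "j \<le> degree X")
    case True
    then have "degree (coeff X j) \<le> (\<Sum>j\<le>degree X. degree (coeff X j))"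
      by (intro member_le_sum) auto
    then show ?thesis by simp
  next
    case False
    then show ?thesis by (simp add: coeff_eq_0)
  qed
qed

text \<open>Supplies the factors needed later: cofactors linear in z3 and, with
  \<open>Y = 0\<close>, factors free of z3.\<close>

lemma is_poly3_ev: "is_poly3 (\<lambda>(z1, z2, z3). ev X z1 z2 + z3 * ev Y z1 z2)"
proof -
  obtain NX where NX: "degree X \<le> NX" "\<And>j. degree (coeff X j) \<le> NX"
    using degree_bound_poly_poly by blast
  obtain NY where NY: "degree Y \<le> NY" "\<And>j. degree (coeff Y j) \<le> NY"
    using degree_bound_poly_poly by blast
  \<comment> \<open>The \<open>Suc\<close> guarantees N \<ge> 1, so that the exponent k = 1 of z3 is
    within range.\<close>
  define N where "N = Suc (max NX NY)"
  have X: "ev X z1 z2 = (\<Sum>i\<le>N. \<Sum>j\<le>N. coeff (coeff X j) i * z1 ^ i * z2 ^ j)" for z1 z2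
    using NX by (intro ev_altdef) (auto simp: N_def intro: le_trans[OF _ le_SucI[OF max.cobounded1]])
  have Y: "ev Y z1 z2 = (\<Sum>i\<le>N. \<Sum>j\<le>N. coeff (coeff Y j) i * z1 ^ i * z2 ^ j)" for z1 z2
    using NY by (intro ev_altdef) (auto simp: N_def intro: le_trans[OF _ le_SucI[OF max.cobounded2]])
  define c where "c i j k = (if k = 0 then coeff (coeff X j) i
    else if k = Suc 0 then coeff (coeff Y j) i else 0)" for i j k :: nat
  have c: "(\<Sum>k\<le>N. c i j k * z1 ^ i * z2 ^ j * z3 ^ k)
      = coeff (coeff X j) i * z1 ^ i * z2 ^ j + z3 * (coeff (coeff Y j) i * z1 ^ i * z2 ^ j)"
    for i j z1 z2 z3
  proof -
    have "(\<Sum>k\<le>N. c i j k * z1 ^ i * z2 ^ j * z3 ^ k)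
        = (\<Sum>k\<in>{0, Suc 0}. c i j k * z1 ^ i * z2 ^ j * z3 ^ k)"
      by (rule sum.mono_neutral_right) (auto simp: c_def N_def)
    then show ?thesis by (simp add: c_def)
  qed
  show ?thesis unfolding is_poly3_def
    by (rule exI[of _ N], rule exI[of _ c])
      (simp add: c X Y sum.distrib sum_distrib_left)
qed

text \<open>A nonzero polynomial over the domain \<open>complex poly\<close> has finitely many
  roots, whereas vanishing everywhere makes every constant \<open>[:z:]\<close> a root.\<close>

lemma ev_eq_0_iff: "(\<forall>z1 z2. ev X z1 z2 = 0) \<longleftrightarrow> X = 0"
proof
  assume *: "\<forall>z1 z2. ev X z1 z2 = 0"
  have "poly X [:z:] = 0" for z
    using * poly_all_0_iff_0 unfolding ev_def by blast
  then have "range (\<lambda>z. [:z:]) \<subseteq> {y. poly X y = 0}" by auto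
  moreover have "infinite (range (\<lambda>z::complex. [:z:]))"
    using infinite_UNIV_char_0 by (subst finite_image_iff) (auto intro: injI)
  ultimately show "X = 0"
    using poly_roots_finite finite_subset by blast
qed simp

text \<open>A common divisor g splits the polynomial as g times X' + z3 Y'. The second factor
  depends on z3 because Y' is nonzero, so irreducibility makes g constant.\<close>

lemma coprime_poly_poly_if_irreducible3:
  assumes irr: "irreducible3 (\<lambda>(z1, z2, z3). ev X z1 z2 + z3 * ev Y z1 z2)"
    and Y: "Y \<noteq> 0"
  shows "coprime X Y"
proof (rule coprimeI)
  fix g assume "g dvd X" "g dvd Y"
  then obtain X' Y' where g: "X = g * X'" "Y = g * Y'" by (auto elim!: dvdE)
  define q r :: "c3 \<Rightarrow> complex" where "q = (\<lambda>(z1, z2, z3). ev g z1 z2)"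
    and "r = (\<lambda>(z1, z2, z3). ev X' z1 z2 + z3 * ev Y' z1 z2)"
  have "is_poly3 q" "is_poly3 r"
    using is_poly3_ev[of g 0] is_poly3_ev[of X' Y'] by (simp_all add: q_def r_def)
  moreover have "\<forall>z. (\<lambda>(z1, z2, z3). ev X z1 z2 + z3 * ev Y z1 z2) z = q z * r z"
    by (auto simp: q_def r_def g algebra_simps)
  ultimately have "const3 q \<or> const3 r" using irr unfolding irreducible3_def by blast
  moreover have "\<not> const3 r"
  proof
    assume "const3 r"
    then obtain c where "\<And>z. r z = c" unfolding const3_def by blast
    then have c: "ev X' z1 z2 + z3 * ev Y' z1 z2 = c" for z1 z2 z3 by (auto simp: r_def)
    have "ev Y' z1 z2 = 0" for z1 z2
      using c[of z1 z2 0] c[of z1 z2 1] by simp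
    then show False using ev_eq_0_iff[of Y'] Y g by simp
  qed
  ultimately obtain c where "\<And>z. q z = c" unfolding const3_def by blast
  then have "ev g z1 z2 = c" for z1 z2 by (auto simp: q_def)
  then have "\<forall>z1 z2. ev (g - [:[:c:]:]) z1 z2 = 0" by (simp add: ev_def)
  then have "g = [:[:c:]:]" using ev_eq_0_iff[of "g - [:[:c:]:]"] by simp
  moreover have "c \<noteq> 0" using calculation Y g by auto
  moreover have "is_unit [:c:]" using calculation by (simp add: is_unit_const_poly_iff dvd_field_iff)
  ultimately show "is_unit g" by (simp add: is_unit_const_poly_iff)
qed

section \<open>Coefficient polynomials of p and of its reflection\<close>

definition coeff_poly :: "(nat \<Rightarrow> nat \<Rightarrow> complex) \<Rightarrow> nat \<Rightarrow> nat \<Rightarrow> complex poly poly" where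
  "coeff_poly c m n = (\<Sum>j\<le>n. monom (\<Sum>i\<le>m. monom (c i j) i) j)"

lemma ev_coeff_poly: "ev (coeff_poly c m n) z1 z2 = (\<Sum>i\<le>m. \<Sum>j\<le>n. c i j * z1 ^ i * z2 ^ j)"
proof -
  have "ev (coeff_poly c m n) z1 z2 = (\<Sum>j\<le>n. \<Sum>i\<le>m. c i j * z1 ^ i * z2 ^ j)"
    by (simp add: ev_def coeff_poly_def poly_sum poly_monom sum_distrib_right)
  then show ?thesis by (subst sum.swap)
qed

lemma sum_nat_rev: "(\<Sum>i\<le>m. f (m - i) i) = (\<Sum>i\<le>m. f i (m - i))" for m :: nat and f :: "nat \<Rightarrow> nat \<Rightarrow> complex"
  by (rule sum.reindex_bij_witness[of _ "\<lambda>i. m - i" "\<lambda>i. m - i"]) auto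

lemma ev_coeff_poly_rev:
  "ev (coeff_poly (\<lambda>i j. c (m - i) (n - j)) m n) z1 z2 = (\<Sum>i\<le>m. \<Sum>j\<le>n. c i j * z1 ^ (m - i) * z2 ^ (n - j))"
  unfolding ev_coeff_poly
    sum_nat_rev[of "\<lambda>k j. c i k * z1 ^ l * z2 ^ j" for i l]
    sum_nat_rev[of "\<lambda>k i. \<Sum>j\<le>n. c k j * z1 ^ i * z2 ^ (n - j)"] ..

text \<open>\<open>X1\<close>, \<open>X2\<close> stand for p_1, p_2 and \<open>Y1\<close>,
  \<open>Y2\<close> for their reflections of bidegree (m,n).\<close>

abbreviation X1 where "X1 a m n \<equiv> coeff_poly (\<lambda>i j. a i j 0) m n"
abbreviation X2 where "X2 a m n \<equiv> coeff_poly (\<lambda>i j. a i j (Suc 0)) m n"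
abbreviation Y1 where "Y1 a m n \<equiv> coeff_poly (\<lambda>i j. cnj (a (m - i) (n - j) 0)) m n"
abbreviation Y2 where "Y2 a m n \<equiv> coeff_poly (\<lambda>i j. cnj (a (m - i) (n - j) (Suc 0))) m n"

lemma Ptil1_ev: "Ptil1 a m n z1 z2 = ev (Y1 a m n) z1 z2"
  and Ptil2_ev: "Ptil2 a m n z1 z2 = ev (Y2 a m n) z1 z2"
  by (simp_all add: Ptil1_def Ptil2_def ev_coeff_poly_rev[where c="\<lambda>i j. cnj (a i j k)" for k])

lemma P_ev: "P a m n = (\<lambda>(z1, z2, z3). ev (X1 a m n) z1 z2 + z3 * ev (X2 a m n) z1 z2)"
  unfolding P_def ev_coeff_poly
  by (auto simp: fun_eq_iff sum.distrib sum_distrib_left algebra_simps)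

lemma Ptil_ev: "Ptil a m n = (\<lambda>(z1, z2, z3). z3 * ev (Y1 a m n) z1 z2 + ev (Y2 a m n) z1 z2)"
  unfolding Ptil1_ev[symmetric] Ptil2_ev[symmetric]  Ptil_def Ptil1_def Ptil2_def
  by (auto simp: fun_eq_iff sum.distrib sum_distrib_left algebra_simps)

lemma coeff_coeff_poly: "i \<le> m \<Longrightarrow> j \<le> n \<Longrightarrow> coeff (coeff (coeff_poly c m n) j) i = c i j"
  by (simp add: coeff_poly_def coeff_sum if_distrib[of "\<lambda>x. coeff x _"] cong: if_cong)

text \<open>The numerator, over p^2, of the z3-derivative of \<phi>; the terms containing z3
  cancel.\<close>

definition jac :: "(nat \<Rightarrow> nat \<Rightarrow> nat \<Rightarrow> complex) \<Rightarrow> nat \<Rightarrow> nat \<Rightarrow> complex poly poly" where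
  "jac a m n = X1 a m n * Y1 a m n - X2 a m n * Y2 a m n"

lemma jac_nonzero:
  assumes deg: "has_degree a m n" and rif: "RIF a m n" and irr: "irreducible3 (P a m n)"
    and nz: "X1 a m n \<noteq> 0"
  shows "jac a m n \<noteq> 0"
proof
  assume "jac a m n = 0"
  then have eq: "X1 a m n * Y1 a m n = X2 a m n * Y2 a m n" by (simp add: jac_def)
  obtain i j where ij: "i \<le> m" "j \<le> n" "a i j (Suc 0) \<noteq> 0"
    using deg unfolding has_degree_def by auto
  then have X2: "X2 a m n \<noteq> 0" using coeff_coeff_poly[of i m j n "\<lambda>i j. a i j (Suc 0)"] by auto
  have cop: "coprime (X1 a m n) (X2 a m n)"
    using coprime_poly_poly_if_irreducible3[OF irr[unfolded P_ev] X2] .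
  have "X1 a m n dvd X2 a m n * Y2 a m n" by (metis eq dvd_triv_left)
  then have "X1 a m n dvd Y2 a m n" using cop by (simp add: coprime_dvd_mult_right_iff)
  \<comment> \<open>From p_2~ = p_1 R the identity forces p_1~ = p_2 R with the same R, hence the
    reflection of p is R p.\<close>
  then obtain R where R: "Y2 a m n = X1 a m n * R" by (elim dvdE)
  have "X1 a m n * Y1 a m n = X1 a m n * (X2 a m n * R)" using eq R by (simp add: mult_ac)
  then have R': "Y1 a m n = X2 a m n * R" using nz by simp
  define r :: "c3 \<Rightarrow> complex" where "r = (\<lambda>(z1, z2, z3). ev R z1 z2)"
  have r: "is_poly3 r" using is_poly3_ev[of R 0] by (simp add: r_def)
  have "\<forall>z. Ptil a m n z = P a m n z * r z"
    by (auto simp: P_ev Ptil_ev r_def R R' algebra_simps)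
  then have "poly_dvd3 (P a m n) (Ptil a m n)" using r unfolding poly_dvd3_def by blast
  moreover have "poly_dvd3 (P a m n) (P a m n)"
  proof -
    have "is_poly3 (\<lambda>(z1, z2, z3). 1)" using is_poly3_ev[of "[:[:1:]:]" 0] by (simp add: ev_def)
    then show ?thesis unfolding poly_dvd3_def by (intro exI[of _ "\<lambda>(z1, z2, z3). 1"]) auto
  qed
  \<comment> \<open>The forbidden common factor is p itself, which irreducibility makes
    nonconstant.\<close>
  ultimately show False
    using irr rif unfolding irreducible3_def RIF_def no_common_factor3_def by blast
qed

text \<open>Slicing: for all but finitely many values of one variable only finitely many values of the
  other give a zero, and finite subsets of the circle have countable preimages under \<open>cis\<close>.\<close>

lemma AE_cis_notin_finite:
  assumes "finite A"
  shows "AE t in lborel. cis t \<notin> A"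
proof -
  have 1: "countable {t. cis t = x}" for x
  proof (cases "\<exists>t. cis t = x")
    case True
    then obtain t0 where t0: "cis t0 = x" by blast
    have "{t. cis t = x} \<subseteq> range (\<lambda>k::int. t0 + 2 * pi * real_of_int k)"
    proof
      fix t assume "t \<in> {t. cis t = x}"
      then have "cis t = cis t0" using t0 by simp
      then have "cos t = cos t0 \<and> sin t = sin t0" by (metis cis.simps)
      then obtain k :: int where "t = t0 + 2 * pi * k"
        using sin_cos_eq_iff[of t t0] by auto
      then show "t \<in> range (\<lambda>k::int. t0 + 2 * pi * real_of_int k)" by blast
    qed
    then show ?thesis by (rule countable_subset) simp
  next
    case False
    then have "{t. cis t = x} = {}" by blast
    then show ?thesis by simp
  qed
  have "{t. cis t \<in> A} = (\<Union>x\<in>A. {t. cis t = x})" by auto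
  then have "countable {t. cis t \<in> A}" using assms 1 by (auto intro: countable_finite)
  then have "{t. cis t \<in> A} \<in> null_sets lborel" by (rule countable_imp_null_set_lborel)
  then show ?thesis by (rule AE_I') auto
qed

lemma ev_eq_sum: "\<exists>N c. \<forall>z1 z2. ev X z1 z2 = (\<Sum>i\<le>N. \<Sum>j\<le>N. c i j * z1 ^ i * z2 ^ j)"
proof -
  obtain N where "degree X \<le> N" "\<And>j. degree (coeff X j) \<le> N"
    using degree_bound_poly_poly by blast
  then have "\<forall>z1 z2. ev X z1 z2 = (\<Sum>i\<le>N. \<Sum>j\<le>N. coeff (coeff X j) i * z1 ^ i * z2 ^ j)"
    using ev_altdef by blast
  then show ?thesis by (intro exI[of _ N] exI[of _ "\<lambda>i j. coeff (coeff X j) i"])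
qed

lemma continuous_on_ev:
  assumes "continuous_on S f" "continuous_on S g"
  shows "continuous_on S (\<lambda>x. ev X (f x) (g x))"
proof -
  obtain N c where "\<And>z1 z2. ev X z1 z2 = (\<Sum>i\<le>N. \<Sum>j\<le>N. c i j * z1 ^ i * z2 ^ j)"
    using ev_eq_sum by blast
  then show ?thesis using assms by (auto intro!: continuous_intros)
qed

lemma AE_ev_cis_nonzero:
  assumes "X \<noteq> 0"
  shows "AE p in lborel. ev X (cis (fst p)) (cis (snd p)) \<noteq> 0"
proof -
  have fin: "finite {z2. poly X [:z2:] = 0}"
  proof -
    have "finite ((\<lambda>z. [:z:]) -` {y. poly X y = 0})"
      by (rule finite_vimageI[OF poly_roots_finite[OF assms]]) (auto intro: injI)
    then show ?thesis by (simp add: vimage_def)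
  qed
  have "open {p. ev X (cis (fst p)) (cis (snd p)) \<noteq> 0}"
    by (intro open_Collect_neq continuous_on_ev) (auto intro!: continuous_intros)
  then have meas: "{p. ev X (cis (fst p)) (cis (snd p)) \<noteq> 0} \<in> sets borel" by simp
  have meas': "{p \<in> space (lborel \<Otimes>\<^sub>M lborel). ev X (cis (fst p)) (cis (snd p)) \<noteq> 0}
      \<in> sets (lborel \<Otimes>\<^sub>M lborel)"
    unfolding lborel_prod using meas by simp
  \<comment> \<open>The nesting of X dictates the order: first exclude the z2 at which X becomes the
    zero polynomial in z1, then finitely many z1. The order is swapped afterwards because the
    product measure lists z1 first.\<close>
  have "AE s in lborel. AE t in lborel. ev X (cis t) (cis s) \<noteq> 0"
    using AE_cis_notin_finite[OF fin]
  proof eventually_elim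
    case (elim s)
    then have "poly X [:cis s:] \<noteq> 0" by simp
    from AE_cis_notin_finite[OF poly_roots_finite[OF this]]
    show ?case by eventually_elim (simp add: ev_def)
  qed
  then have "AE t in lborel. AE s in lborel. ev X (cis t) (cis s) \<noteq> 0"
    using lborel_pair.AE_commute[OF meas'] by blast
  with meas' have "AE p in lborel \<Otimes>\<^sub>M lborel. ev X (cis (fst p)) (cis (snd p)) \<noteq> 0"
    by (intro lborel_pair.AE_pair_measure) simp_all
  then show ?thesis unfolding lborel_prod .
qed

subsection \<open>Smooth functions of two angles\<close>

text \<open>A class closed under both partial derivatives, whose members are continuous and so
  bounded on compact sets. Membership of \<rho> thus yields all derivatives and remainder bounds of
  its Taylor expansion at once.\<close>

inductive smooth2 :: "(real \<Rightarrow> real \<Rightarrow> real) \<Rightarrow> bool" where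
  const: "smooth2 (\<lambda>t s. c)"
| cos1: "smooth2 (\<lambda>t s. cos t)"
| sin1: "smooth2 (\<lambda>t s. sin t)"
| cos2: "smooth2 (\<lambda>t s. cos s)"
| sin2: "smooth2 (\<lambda>t s. sin s)"
| add: "smooth2 f \<Longrightarrow> smooth2 g \<Longrightarrow> smooth2 (\<lambda>t s. f t s + g t s)"
| mult: "smooth2 f \<Longrightarrow> smooth2 g \<Longrightarrow> smooth2 (\<lambda>t s. f t s * g t s)"
| inverse: "smooth2 f \<Longrightarrow> (\<And>t s. f t s \<noteq> 0) \<Longrightarrow> smooth2 (\<lambda>t s. inverse (f t s))"

lemma smooth2_minus: "smooth2 f \<Longrightarrow> smooth2 (\<lambda>t s. - f t s)"
  using smooth2.mult[OF smooth2.const[of "-1"]] by simp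

lemma smooth2_diff: "smooth2 f \<Longrightarrow> smooth2 g \<Longrightarrow> smooth2 (\<lambda>t s. f t s - g t s)"
  using smooth2.add[OF _ smooth2_minus[of g]] by simp

lemma smooth2_swap: "smooth2 f \<Longrightarrow> smooth2 (\<lambda>t s. f s t)"
  by (induction rule: smooth2.induct) (auto intro: smooth2.intros)

lemma smooth2_partial1:
  assumes "smooth2 f"
  shows "\<exists>g. smooth2 g \<and> (\<forall>t s. ((\<lambda>t. f t s) has_real_derivative g t s) (at t))"
  using assms
proof (induction rule: smooth2.induct)
  case (const c)
  show ?case by (intro exI[of _ "\<lambda>t s. 0"]) (auto intro: smooth2.intros)
next
  case cos1
  show ?case
    by (intro exI[of _ "\<lambda>t s. - sin t"]) (auto intro: smooth2.intros smooth2_minus intro!: derivative_eq_intros)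
next
  case sin1
  show ?case
    by (intro exI[of _ "\<lambda>t s. cos t"]) (auto intro: smooth2.intros intro!: derivative_eq_intros)
next
  case cos2
  show ?case by (intro exI[of _ "\<lambda>t s. 0"]) (auto intro: smooth2.intros)
next
  case sin2
  show ?case by (intro exI[of _ "\<lambda>t s. 0"]) (auto intro: smooth2.intros)
next
  case (add f g)
  then obtain f' g' where "smooth2 f'" "smooth2 g'"
    "\<And>t s. ((\<lambda>t. f t s) has_real_derivative f' t s) (at t)"
    "\<And>t s. ((\<lambda>t. g t s) has_real_derivative g' t s) (at t)" by blast
  then show ?case
    by (intro exI[of _ "\<lambda>t s. f' t s + g' t s"]) (auto intro: smooth2.intros intro!: derivative_eq_intros)
next
  case (mult f g)
  then obtain f' g' where "smooth2 f'" "smooth2 g'"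
    "\<And>t s. ((\<lambda>t. f t s) has_real_derivative f' t s) (at t)"
    "\<And>t s. ((\<lambda>t. g t s) has_real_derivative g' t s) (at t)" by blast
  with mult.hyps show ?case
    by (intro exI[of _ "\<lambda>t s. f' t s * g t s + f t s * g' t s"])
      (auto intro!: smooth2.add smooth2.mult derivative_eq_intros)
next
  case (inverse f)
  then obtain f' where "smooth2 f'"
    "\<And>t s. ((\<lambda>t. f t s) has_real_derivative f' t s) (at t)" by blast
  with inverse.hyps show ?case
    by (intro exI[of _ "\<lambda>t s. - (inverse (f t s) * f' t s * inverse (f t s))"])
      (auto intro!: smooth2.intros(6-) smooth2_minus DERIV_inverse')
qed

lemma smooth2_partial2:
  assumes "smooth2 f"
  shows "\<exists>g. smooth2 g \<and> (\<forall>t s. ((\<lambda>s. f t s) has_real_derivative g t s) (at s))"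
  using smooth2_partial1[OF smooth2_swap[OF assms]] smooth2_swap by blast

lemma smooth2_continuous:
  assumes "smooth2 f"
  shows "continuous_on S (\<lambda>p. f (fst p) (snd p))"
  using assms by (induction rule: smooth2.induct) (auto intro!: continuous_intros)

lemma smooth2_bounded:
  assumes "smooth2 f"
  obtains K where "0 < K" "\<And>t s. \<bar>t\<bar> \<le> 1 \<Longrightarrow> \<bar>s\<bar> \<le> 1 \<Longrightarrow> \<bar>f t s\<bar> \<le> K"
proof -
  have "compact ({-1..1::real} \<times> {-1..1::real})" by (intro compact_Times) auto
  then have "bounded ((\<lambda>p. f (fst p) (snd p)) ` ({-1..1} \<times> {-1..1}))"
    by (intro compact_imp_bounded compact_continuous_image smooth2_continuous assms)
  then obtain K where K: "0 < K" "\<forall>x\<in>(\<lambda>p. f (fst p) (snd p)) ` ({-1..1} \<times> {-1..1}). norm x \<le> K"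
    unfolding bounded_pos by blast
  show ?thesis
  proof
    show "0 < K" by fact
    show "\<bar>f t s\<bar> \<le> K" if "\<bar>t\<bar> \<le> 1" "\<bar>s\<bar> \<le> 1" for t s
    proof -
      have "f t s \<in> (\<lambda>p. f (fst p) (snd p)) ` ({-1..1} \<times> {-1..1})"
        using that by (intro image_eqI[of _ _ "(t, s)"]) auto
      then show ?thesis using K by auto
    qed
  qed
qed

lemma taylor1:
  fixes f0 :: "real \<Rightarrow> real"
  assumes "\<And>x. (f0 has_real_derivative f1 x) (at x)" "\<And>x. \<bar>x\<bar> \<le> \<bar>t\<bar> \<Longrightarrow> \<bar>f1 x\<bar> \<le> K"
  shows "\<bar>f0 t - f0 0\<bar> \<le> K * \<bar>t\<bar>"
proof -
  \<comment> \<open>\<open>Maclaurin_bi_le\<close> takes a sequence of derivatives; entries beyond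
    the order in use are filler.\<close>
  define d where "d k = (if k = 0 then f0 else f1)" for k :: nat
  obtain x where "\<bar>x\<bar> \<le> \<bar>t\<bar>" "f0 t = (\<Sum>m<1. d m 0 / fact m * t ^ m) + d 1 x / fact 1 * t ^ 1"
    using Maclaurin_bi_le[of d f0 1 t] assms(1) by (auto simp: d_def)
  then show ?thesis using assms(2)[of x] by (auto simp: d_def abs_mult mult_right_mono)
qed

lemma taylor2:
  fixes f0 :: "real \<Rightarrow> real"
  assumes "\<And>x. (f0 has_real_derivative f1 x) (at x)" "\<And>x. (f1 has_real_derivative f2 x) (at x)"
    "\<And>x. \<bar>x\<bar> \<le> \<bar>t\<bar> \<Longrightarrow> \<bar>f2 x\<bar> \<le> K"
  shows "\<bar>f0 t - (f0 0 + f1 0 * t)\<bar> \<le> K * \<bar>t\<bar> ^ 2"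
proof -
  define d where "d k = (if k = 0 then f0 else if k = 1 then f1 else f2)" for k :: nat
  have "\<forall>m t. m < 2 \<longrightarrow> (d m has_real_derivative d (Suc m) t) (at t)"
    using assms(1,2) by (auto simp: d_def less_Suc_eq numeral_2_eq_2)
  then obtain x where x: "\<bar>x\<bar> \<le> \<bar>t\<bar>" "f0 t = (\<Sum>m<2. d m 0 / fact m * t ^ m) + d 2 x / fact 2 * t ^ 2"
    using Maclaurin_bi_le[of d f0 2 t] by (auto simp: d_def[of 0])
  then have "f0 t - (f0 0 + f1 0 * t) = f2 x / 2 * t\<^sup>2"
    by (simp add: d_def numeral_2_eq_2)
  then have "\<bar>f0 t - (f0 0 + f1 0 * t)\<bar> = \<bar>f2 x / 2\<bar> * \<bar>t\<bar> ^ 2"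
    by (simp only: abs_mult power_abs)
  moreover have "\<bar>f2 x / 2\<bar> \<le> K" using assms(3)[OF x(1)] by linarith
  ultimately show ?thesis by (simp only: mult_right_mono zero_le_power abs_ge_zero)
qed

lemma taylor3:
  fixes f0 :: "real \<Rightarrow> real"
  assumes "\<And>x. (f0 has_real_derivative f1 x) (at x)" "\<And>x. (f1 has_real_derivative f2 x) (at x)"
    "\<And>x. (f2 has_real_derivative f3 x) (at x)"
    "\<And>x. \<bar>x\<bar> \<le> \<bar>t\<bar> \<Longrightarrow> \<bar>f3 x\<bar> \<le> K"
  shows "\<bar>f0 t - (f0 0 + f1 0 * t + f2 0 / 2 * t\<^sup>2)\<bar> \<le> K * \<bar>t\<bar> ^ 3"
proof -
  define d where "d k = (if k = 0 then f0 else if k = 1 then f1 else if k = 2 then f2 else f3)" for k :: nat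
  have "\<forall>m t. m < 3 \<longrightarrow> (d m has_real_derivative d (Suc m) t) (at t)"
    using assms(1,2,3) by (auto simp: d_def less_Suc_eq numeral_2_eq_2 numeral_3_eq_3)
  then obtain x where x: "\<bar>x\<bar> \<le> \<bar>t\<bar>" "f0 t = (\<Sum>m<3. d m 0 / fact m * t ^ m) + d 3 x / fact 3 * t ^ 3"
    using Maclaurin_bi_le[of d f0 3 t] by (auto simp: d_def[of 0])
  then have "f0 t - (f0 0 + f1 0 * t + f2 0 / 2 * t\<^sup>2) = f3 x / 6 * t ^ 3"
    by (simp add: d_def numeral_2_eq_2 numeral_3_eq_3)
  then have "\<bar>f0 t - (f0 0 + f1 0 * t + f2 0 / 2 * t\<^sup>2)\<bar> = \<bar>f3 x / 6\<bar> * \<bar>t\<bar> ^ 3"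
    by (simp only: abs_mult power_abs)
  moreover have "\<bar>f3 x / 6\<bar> \<le> K" using assms(4)[OF x(1)] by linarith
  ultimately show ?thesis by (simp only: mult_right_mono zero_le_power abs_ge_zero)
qed

text \<open>Expanding first in \<open>t\<close> and then expanding the coefficients in \<open>s\<close> needs neither a chain
  rule nor the symmetry of second derivatives, and the mixed coefficient comes out in the order in
  which \<open>c11\<close> differentiates.\<close>

lemma smooth2_quadratic_at_min:
  assumes f: "smooth2 f" and nonneg: "\<And>t s. 0 \<le> f t s" and zero: "f 0 0 = 0"
  obtains K where "0 < K" "\<And>t s. \<bar>t\<bar> \<le> 1 \<Longrightarrow> \<bar>s\<bar> \<le> 1 \<Longrightarrow>
    \<bar>f t s - (deriv (deriv (\<lambda>t. f t 0)) 0 / 2 * t\<^sup>2 + deriv (\<lambda>s. deriv (\<lambda>t. f t s) 0) 0 * t * s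
        + deriv (deriv (\<lambda>s. f 0 s)) 0 / 2 * s\<^sup>2)\<bar> \<le> K * (\<bar>t\<bar> + \<bar>s\<bar>) ^ 3"
proof -
  obtain f1 where f1: "smooth2 f1" "\<And>t s. ((\<lambda>t. f t s) has_real_derivative f1 t s) (at t)"
    using smooth2_partial1[OF f] by blast
  obtain f11 where f11: "smooth2 f11" "\<And>t s. ((\<lambda>t. f1 t s) has_real_derivative f11 t s) (at t)"
    using smooth2_partial1[OF f1(1)] by blast
  obtain f111 where f111: "smooth2 f111" "\<And>t s. ((\<lambda>t. f11 t s) has_real_derivative f111 t s) (at t)"
    using smooth2_partial1[OF f11(1)] by blast
  obtain f112 where f112: "smooth2 f112" "\<And>t s. ((\<lambda>s. f11 t s) has_real_derivative f112 t s) (at s)"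
    using smooth2_partial2[OF f11(1)] by blast
  obtain f12 where f12: "smooth2 f12" "\<And>t s. ((\<lambda>s. f1 t s) has_real_derivative f12 t s) (at s)"
    using smooth2_partial2[OF f1(1)] by blast
  obtain f122 where f122: "smooth2 f122" "\<And>t s. ((\<lambda>s. f12 t s) has_real_derivative f122 t s) (at s)"
    using smooth2_partial2[OF f12(1)] by blast
  obtain f2 where f2: "smooth2 f2" "\<And>t s. ((\<lambda>s. f t s) has_real_derivative f2 t s) (at s)"
    using smooth2_partial2[OF f] by blast
  obtain f22 where f22: "smooth2 f22" "\<And>t s. ((\<lambda>s. f2 t s) has_real_derivative f22 t s) (at s)"
    using smooth2_partial2[OF f2(1)] by blast
  obtain f222 where f222: "smooth2 f222" "\<And>t s. ((\<lambda>s. f22 t s) has_real_derivative f222 t s) (at s)"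
    using smooth2_partial2[OF f22(1)] by blast
  have d1: "deriv (\<lambda>t. f t s) = (\<lambda>t. f1 t s)" for s
    by (intro ext DERIV_imp_deriv f1)
  have d2: "deriv (\<lambda>s. f t s) = (\<lambda>s. f2 t s)" for t
    by (intro ext DERIV_imp_deriv f2)
  have c20: "deriv (deriv (\<lambda>t. f t 0)) 0 = f11 0 0"
    unfolding d1 by (intro DERIV_imp_deriv f11)
  have c02: "deriv (deriv (\<lambda>s. f 0 s)) 0 = f22 0 0"
    unfolding d2 by (intro DERIV_imp_deriv f22)
  have c11: "deriv (\<lambda>s. deriv (\<lambda>t. f t s) 0) 0 = f12 0 0"
    unfolding d1 by (intro DERIV_imp_deriv f12)
  \<comment> \<open>The origin is a minimum in each variable separately, which removes the linear
    terms.\<close>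
  have f1_0: "f1 0 0 = 0"
    by (rule DERIV_local_min[OF f1(2)[of 0 0], of 1]) (auto simp: zero nonneg)
  have f2_0: "f2 0 0 = 0"
    by (rule DERIV_local_min[OF f2(2)[of 0 0], of 1]) (auto simp: zero nonneg)
  obtain K1 where K1: "0 < K1" "\<And>t s. \<bar>t\<bar> \<le> 1 \<Longrightarrow> \<bar>s\<bar> \<le> 1 \<Longrightarrow> \<bar>f111 t s\<bar> \<le> K1"
    using smooth2_bounded[OF f111(1)] by blast
  obtain K2 where K2: "0 < K2" "\<And>t s. \<bar>t\<bar> \<le> 1 \<Longrightarrow> \<bar>s\<bar> \<le> 1 \<Longrightarrow> \<bar>f112 t s\<bar> \<le> K2"
    using smooth2_bounded[OF f112(1)] by blast
  obtain K3 where K3: "0 < K3" "\<And>t s. \<bar>t\<bar> \<le> 1 \<Longrightarrow> \<bar>s\<bar> \<le> 1 \<Longrightarrow> \<bar>f122 t s\<bar> \<le> K3"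
    using smooth2_bounded[OF f122(1)] by blast
  obtain K4 where K4: "0 < K4" "\<And>t s. \<bar>t\<bar> \<le> 1 \<Longrightarrow> \<bar>s\<bar> \<le> 1 \<Longrightarrow> \<bar>f222 t s\<bar> \<le> K4"
    using smooth2_bounded[OF f222(1)] by blast
  define K where "K = K1 + K2 + K3 + K4"
  show ?thesis
  proof
    show "0 < K" using K1 K2 K3 K4 by (simp add: K_def)
    fix t s :: real assume t: "\<bar>t\<bar> \<le> 1" and s: "\<bar>s\<bar> \<le> 1"
    \<comment> \<open>\<open>e1\<close> expands in t for fixed s; \<open>e2\<close> to
      \<open>e4\<close> expand its coefficients at t = 0, each just far enough to leave a remainder
      of total degree 3.\<close>
    have e1: "\<bar>f t s - (f 0 s + f1 0 s * t + f11 0 s / 2 * t\<^sup>2)\<bar> \<le> K1 * \<bar>t\<bar> ^ 3"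
      by (rule taylor3[OF f1(2) f11(2) f111(2)]) (use t s K1 in auto)
    have e2: "\<bar>f11 0 s - f11 0 0\<bar> \<le> K2 * \<bar>s\<bar>"
      by (rule taylor1[OF f112(2)]) (use t s K2 in auto)
    have e3: "\<bar>f1 0 s - (f1 0 0 + f12 0 0 * s)\<bar> \<le> K3 * \<bar>s\<bar> ^ 2"
      by (rule taylor2[OF f12(2) f122(2)]) (use t s K3 in auto)
    have e4: "\<bar>f 0 s - (f 0 0 + f2 0 0 * s + f22 0 0 / 2 * s\<^sup>2)\<bar> \<le> K4 * \<bar>s\<bar> ^ 3"
      by (rule taylor3[OF f2(2) f22(2) f222(2)]) (use t s K4 in auto)
    define T S where "T = \<bar>t\<bar>" and "S = \<bar>s\<bar>"
    have TS: "0 \<le> T" "0 \<le> S" by (auto simp: T_def S_def)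
    have "\<bar>f t s - (f11 0 0 / 2 * t\<^sup>2 + f12 0 0 * t * s + f22 0 0 / 2 * s\<^sup>2)\<bar>
      = \<bar>(f t s - (f 0 s + f1 0 s * t + f11 0 s / 2 * t\<^sup>2)) + (f11 0 s - f11 0 0) / 2 * t\<^sup>2
        + (f1 0 s - (f1 0 0 + f12 0 0 * s)) * t + (f 0 s - (f 0 0 + f2 0 0 * s + f22 0 0 / 2 * s\<^sup>2))\<bar>"
      by (simp add: f1_0 f2_0 zero algebra_simps diff_divide_distrib)
    also have "\<dots> \<le> \<bar>f t s - (f 0 s + f1 0 s * t + f11 0 s / 2 * t\<^sup>2)\<bar> + \<bar>(f11 0 s - f11 0 0) / 2 * t\<^sup>2\<bar>
        + \<bar>(f1 0 s - (f1 0 0 + f12 0 0 * s)) * t\<bar> + \<bar>f 0 s - (f 0 0 + f2 0 0 * s + f22 0 0 / 2 * s\<^sup>2)\<bar>"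
      by linarith
    also have "\<bar>(f11 0 s - f11 0 0) / 2 * t\<^sup>2\<bar> = \<bar>f11 0 s - f11 0 0\<bar> / 2 * T\<^sup>2"
      by (simp add: T_def abs_mult)
    also have "\<bar>(f1 0 s - (f1 0 0 + f12 0 0 * s)) * t\<bar> = \<bar>f1 0 s - (f1 0 0 + f12 0 0 * s)\<bar> * T"
      by (simp add: T_def abs_mult)
    also have "\<bar>f t s - (f 0 s + f1 0 s * t + f11 0 s / 2 * t\<^sup>2)\<bar> + \<bar>f11 0 s - f11 0 0\<bar> / 2 * T\<^sup>2
        + \<bar>f1 0 s - (f1 0 0 + f12 0 0 * s)\<bar> * T + \<bar>f 0 s - (f 0 0 + f2 0 0 * s + f22 0 0 / 2 * s\<^sup>2)\<bar>
      \<le> K1 * T ^ 3 + K2 * S * T\<^sup>2 + K3 * S\<^sup>2 * T + K4 * S ^ 3"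
    proof -
      have "\<bar>f11 0 s - f11 0 0\<bar> / 2 * T\<^sup>2 \<le> K2 * S * T\<^sup>2"
        using e2 K2(1) by (intro mult_right_mono) (auto simp: S_def)
      moreover have "\<bar>f1 0 s - (f1 0 0 + f12 0 0 * s)\<bar> * T \<le> K3 * S\<^sup>2 * T"
        using e3 TS by (intro mult_right_mono) (auto simp: S_def)
      ultimately show ?thesis using e1 e4 unfolding T_def S_def by linarith
    qed
    also have "\<dots> \<le> K * (T + S) ^ 3"
    proof -
      have "T ^ 3 \<le> (T + S) ^ 3" "S ^ 3 \<le> (T + S) ^ 3"
        using TS by (auto intro!: power_mono)
      moreover have "S * T\<^sup>2 \<le> (T + S) * (T + S)\<^sup>2" "S\<^sup>2 * T \<le> (T + S)\<^sup>2 * (T + S)"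
        using TS by (auto intro!: mult_mono power_mono)
      then have "S * T\<^sup>2 \<le> (T + S) ^ 3" "S\<^sup>2 * T \<le> (T + S) ^ 3"
        by (simp_all add: power3_eq_cube power2_eq_square mult_ac)
      ultimately have "K1 * T ^ 3 + K2 * (S * T\<^sup>2) + K3 * (S\<^sup>2 * T) + K4 * S ^ 3
        \<le> K1 * (T + S) ^ 3 + K2 * (T + S) ^ 3 + K3 * (T + S) ^ 3 + K4 * (T + S) ^ 3"
        using K1(1) K2(1) K3(1) K4(1) by (intro add_mono mult_left_mono) auto
      then show ?thesis by (simp add: K_def algebra_simps)
    qed
    finally show "\<bar>f t s - (deriv (deriv (\<lambda>t. f t 0)) 0 / 2 * t\<^sup>2 + deriv (\<lambda>s. deriv (\<lambda>t. f t s) 0) 0 * t * s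
        + deriv (deriv (\<lambda>s. f 0 s)) 0 / 2 * s\<^sup>2)\<bar> \<le> K * (\<bar>t\<bar> + \<bar>s\<bar>) ^ 3"
      unfolding c20 c11 c02 T_def S_def .
  qed
qed

section \<open>Complex-valued smooth functions of two angles\<close>

definition smooth2c :: "(real \<Rightarrow> real \<Rightarrow> complex) \<Rightarrow> bool" where
  "smooth2c f \<longleftrightarrow> smooth2 (\<lambda>t s. Re (f t s)) \<and> smooth2 (\<lambda>t s. Im (f t s))"

lemma smooth2c_const: "smooth2c (\<lambda>t s. c)"
  by (simp add: smooth2c_def smooth2.const)

lemma smooth2c_cis: "smooth2c (\<lambda>t s. cis t)" "smooth2c (\<lambda>t s. cis s)"
  by (simp_all add: smooth2c_def smooth2.intros)

lemma smooth2c_add: "smooth2c f \<Longrightarrow> smooth2c g \<Longrightarrow> smooth2c (\<lambda>t s. f t s + g t s)"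
  by (simp add: smooth2c_def smooth2.add)

lemma smooth2c_mult: "smooth2c f \<Longrightarrow> smooth2c g \<Longrightarrow> smooth2c (\<lambda>t s. f t s * g t s)"
  by (simp add: smooth2c_def smooth2.intros smooth2_diff)

lemma smooth2c_power: "smooth2c f \<Longrightarrow> smooth2c (\<lambda>t s. f t s ^ k)"
  by (induction k) (simp_all add: smooth2c_const smooth2c_mult)

lemma smooth2c_sum:
  assumes "\<And>i. i \<in> I \<Longrightarrow> smooth2c (f i)"
  shows "smooth2c (\<lambda>t s. \<Sum>i\<in>I. f i t s)"
  using assms by (induction I rule: infinite_finite_induct) (simp_all add: smooth2c_const smooth2c_add)

lemma smooth2_norm_sq:
  assumes "smooth2c f"
  shows "smooth2 (\<lambda>t s. (cmod (f t s))\<^sup>2)"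
  using assms unfolding cmod_power2 smooth2c_def
  by (auto simp: power2_eq_square intro!: smooth2.add smooth2.mult)

lemma smooth2c_ev: "smooth2c (\<lambda>t s. ev X (cis t) (cis s))"
proof -
  obtain N c where "\<And>z1 z2. ev X z1 z2 = (\<Sum>i\<le>N. \<Sum>j\<le>N. c i j * z1 ^ i * z2 ^ j)"
    using ev_eq_sum by blast
  then show ?thesis
    by (simp add: smooth2c_sum smooth2c_mult smooth2c_power smooth2c_cis smooth2c_const)
qed

subsection \<open>The Poisson kernel\<close>

lemma chord_le: "cmod (cis t - 1) \<le> \<bar>t\<bar>"
proof -
  have "cmod (cis t - 1) = 2 * \<bar>sin (t / 2)\<bar>"
    using dist_exp_i_1[of t] by (simp add: cis_conv_exp)
  then show ?thesis using abs_sin_x_le_abs_x[of "t / 2"] by simp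
qed

text \<open>Jordan's inequality: a concave function lies above its chords, here the one from 0 to
  pi/2.\<close>

lemma sin_ge_chord:
  assumes "0 \<le> x" "x \<le> pi / 2"
  shows "2 * x / pi \<le> sin x"
proof -
  have "concave_on {0..pi} sin"
    by (rule f''_le0_imp_concave[where f' = cos and f'' = "\<lambda>x. - sin x"])
      (auto intro!: derivative_eq_intros sin_ge_zero)
  then have "(1 - 2 * x / pi) * sin 0 + (2 * x / pi) * sin (pi / 2)
      \<le> sin ((1 - 2 * x / pi) *\<^sub>R 0 + (2 * x / pi) *\<^sub>R (pi / 2))"
    using assms by (intro concave_onD) (auto simp: field_simps)
  then show ?thesis by simp
qed

lemma chord_ge:
  assumes "\<bar>t\<bar> \<le> pi"
  shows "\<bar>t\<bar> / 2 \<le> cmod (cis t - 1)"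
proof -
  have "cmod (cis t - 1) = 2 * \<bar>sin (t / 2)\<bar>"
    using dist_exp_i_1[of t] by (simp add: cis_conv_exp)
  also have "\<bar>sin (t / 2)\<bar> = \<bar>sin (\<bar>t\<bar> / 2)\<bar>" by (cases "t \<ge> 0") auto
  finally have "cmod (cis t - 1) = 2 * \<bar>sin (\<bar>t\<bar> / 2)\<bar>" .
  moreover have "2 * (\<bar>t\<bar> / 2) / pi \<le> sin (\<bar>t\<bar> / 2)"
    using assms by (intro sin_ge_chord) auto
  moreover have "\<bar>t\<bar> / 4 \<le> \<bar>t\<bar> / pi"
    using pi_less_4 by (intro divide_left_mono) auto
  ultimately show ?thesis by linarith
qed

definition poisson :: "complex \<Rightarrow> real \<Rightarrow> real" where
  "poisson w x = (1 - (cmod w)\<^sup>2) / (cmod (1 + cis x * w))\<^sup>2"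

text \<open>A rotation by the argument of -w: the denominator depends only on |w| and on the offset
  x - a from the peak a of the kernel.\<close>

lemma poisson_polar:
  obtains a where "- pi \<le> a" "a < pi" "\<And>x. cmod (1 + cis x * w) = cmod (1 - of_real (cmod w) * cis (x - a))"
proof
  show "- pi \<le> - Arg (- w)" "- Arg (- w) < pi" using Arg_bounded[of "- w"] by auto
  fix x
  have "cis x * w = - (cis x * rcis (cmod w) (Arg (- w)))"
    using rcis_cmod_Arg[of "- w"] by simp
  also have "\<dots> = - (of_real (cmod w) * cis (x - (- Arg (- w))))"
    by (simp add: rcis_def cis_mult[symmetric])
  finally show "cmod (1 + cis x * w) = cmod (1 - of_real (cmod w) * cis (x - (- Arg (- w))))"
    by simp
qed

text \<open>The denominator is the radial gap 1 - r plus r times the chord 1 - e^(it); since 1 - r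
  \<le> 1 - r^2, the gap is at most \<rho>.\<close>

lemma kernel_denominator_le:
  assumes "0 \<le> r" "r \<le> 1"
  shows "cmod (1 - of_real r * cis t) \<le> (1 - r\<^sup>2) + \<bar>t\<bar>"
proof -
  have "1 - of_real r * cis t = of_real (1 - r) + of_real r * (1 - cis t)"
    by (simp add: algebra_simps)
  then have "cmod (1 - of_real r * cis t) \<le> cmod (of_real (1 - r)) + cmod (of_real r * (1 - cis t))"
    using norm_triangle_ineq by metis
  also have "\<dots> = (1 - r) + r * cmod (cis t - 1)"
    using assms by (simp add: norm_mult norm_minus_commute del: of_real_diff)
  also have "\<dots> \<le> (1 - r\<^sup>2) + 1 * \<bar>t\<bar>"
    using assms chord_le[of t] by (intro add_mono mult_mono) (auto simp: power2_eq_square mult_left_le)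
  finally show ?thesis by simp
qed

text \<open>The denominator is at least 1 - r, and 1 - r^2 \<le> 2(1 - r). For the second bound, the
  chord is at most the denominator plus 1 - r, hence at most twice the denominator.\<close>

lemma kernel_denominator_ge:
  assumes "0 \<le> r" "r \<le> 1"
  shows "(1 - r\<^sup>2) / 2 \<le> cmod (1 - of_real r * cis t)"
    and "\<bar>t\<bar> \<le> pi \<Longrightarrow> \<bar>t\<bar> / 4 \<le> cmod (1 - of_real r * cis t)"
proof -
  have "cmod 1 - cmod (of_real r * cis t) \<le> cmod (1 - of_real r * cis t)"
    by (rule norm_triangle_ineq2)
  then have 1: "1 - r \<le> cmod (1 - of_real r * cis t)" using assms by (simp add: norm_mult)
  have "(1 - r\<^sup>2) / 2 \<le> 1 - r"
  proof -
    have "1 - r\<^sup>2 = 2 * (1 - r) - (1 - r)\<^sup>2" by (simp add: power2_eq_square algebra_simps)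
    then have "1 - r\<^sup>2 \<le> 2 * (1 - r)" by simp
    then show ?thesis by simp
  qed
  with 1 show "(1 - r\<^sup>2) / 2 \<le> cmod (1 - of_real r * cis t)" by linarith
  assume "\<bar>t\<bar> \<le> pi"
  from chord_ge[OF this] have "\<bar>t\<bar> / 2 \<le> cmod (cis t - 1)" .
  also have "cmod (cis t - 1) = cmod ((1 - of_real r * cis t) - of_real (1 - r) * cis t)"
    by (subst norm_minus_commute) (simp add: algebra_simps)
  also have "\<dots> \<le> cmod (1 - of_real r * cis t) + cmod (of_real (1 - r) * cis t)"
    by (rule norm_triangle_ineq4)
  also have "cmod (of_real (1 - r) * cis t) = 1 - r"
    using assms by (simp add: norm_mult del: of_real_diff)
  finally show "\<bar>t\<bar> / 4 \<le> cmod (1 - of_real r * cis t)" using 1 by linarith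
qed

text \<open>Near its peak, on a set of length \<open>\<rho> = 1 - |w|\<^sup>2\<close>, the kernel is at least \<open>1 / (4\<rho>)\<close>.\<close>

lemma poisson_powr_integral_ge:
  assumes w: "cmod w < 1" and q: "1 \<le> q"
  shows "ennreal (4 powr (- q) * (1 - (cmod w)\<^sup>2) powr (1 - q))
    \<le> (\<integral>\<^sup>+ x. ennreal (poisson w x powr q) * indicator {- pi<..pi} x \<partial>lborel)"
proof -
  obtain a where a: "- pi \<le> a" "a < pi"
    "\<And>x. cmod (1 + cis x * w) = cmod (1 - of_real (cmod w) * cis (x - a))"
    using poisson_polar[of w] by blast
  define \<rho> where "\<rho> = 1 - (cmod w)\<^sup>2"
  have \<rho>: "0 < \<rho>" "\<rho> \<le> 1" using w by (auto simp: \<rho>_def abs_square_less_1 power_less_one_iff)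
  \<comment> \<open>The interval of length \<rho> has the peak a as an endpoint and lies on the side
    facing 0, so it does not leave the period.\<close>
  define b where "b = (if a < 0 then a else a - \<rho>)"
  have sub: "{b<..<b + \<rho>} \<subseteq> {- pi<..pi}" using a \<rho> pi_gt3 by (auto simp: b_def split: if_splits)
  have ge: "(1 / (4 * \<rho>)) powr q \<le> poisson w x powr q" if "x \<in> {b<..<b + \<rho>}" for x
  proof (rule powr_mono2)
    have "\<bar>x - a\<bar> \<le> \<rho>" using that by (auto simp: b_def split: if_splits)
    then have 1: "cmod (1 + cis x * w) \<le> 2 * \<rho>"
      using kernel_denominator_le[of "cmod w" "x - a"] w a(3)[of x] by (simp add: \<rho>_def)
    have "0 < \<rho> / 2" using \<rho> by simp
    also have "\<rho> / 2 \<le> cmod (1 + cis x * w)"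
      using kernel_denominator_ge(1)[of "cmod w" "x - a"] w a(3)[of x] by (simp add: \<rho>_def)
    finally have 2: "0 < cmod (1 + cis x * w)" .
    have "1 / (4 * \<rho>) = \<rho> / (2 * \<rho>)\<^sup>2" using \<rho> by (simp add: power2_eq_square)
    also have "\<dots> \<le> \<rho> / (cmod (1 + cis x * w))\<^sup>2"
      using 1 2 \<rho> by (intro divide_left_mono power_mono mult_pos_pos zero_less_power) auto
    finally show "1 / (4 * \<rho>) \<le> poisson w x" by (simp add: poisson_def \<rho>_def)
  qed (use q \<rho> in auto)
  have "4 powr (- q) * \<rho> powr (1 - q) = (1 / (4 * \<rho>)) powr q * \<rho>"
    using \<rho> by (simp add: powr_divide powr_mult powr_minus powr_diff field_simps)
  then have "ennreal (4 powr (- q) * \<rho> powr (1 - q))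
      = (\<integral>\<^sup>+ x. ennreal ((1 / (4 * \<rho>)) powr q) * indicator {b<..<b + \<rho>} x \<partial>lborel)"
    using \<rho> by (simp add: nn_integral_cmult_indicator ennreal_mult)
  also have "\<dots> \<le> (\<integral>\<^sup>+ x. ennreal (poisson w x powr q) * indicator {- pi<..pi} x \<partial>lborel)"
    using ge sub by (intro nn_integral_mono) (auto simp: indicator_def intro!: ennreal_leI)
  finally show ?thesis by (simp add: \<rho>_def)
qed

text \<open>The \<open>q\<close>-th power is at most \<open>(4/\<rho>)\<^bsup>q-1\<^esup>\<close> times the kernel, whose integral is bounded; the
  three translates account for \<open>x - a\<close> ranging over \<open>[-2\<pi>, 2\<pi>]\<close>.\<close>

lemma poisson_powr_integral_le:
  assumes w: "cmod w < 1" and q: "1 \<le> q"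
  shows "(\<integral>\<^sup>+ x. ennreal (poisson w x powr q) * indicator {- pi<..pi} x \<partial>lborel)
    \<le> ennreal (4 powr (q - 1) * 96 * pi * (1 - (cmod w)\<^sup>2) powr (1 - q))"
proof -
  obtain a where a: "- pi \<le> a" "a < pi"
    "\<And>x. cmod (1 + cis x * w) = cmod (1 - of_real (cmod w) * cis (x - a))"
    using poisson_polar[of w] by blast
  define \<rho> where "\<rho> = 1 - (cmod w)\<^sup>2"
  have \<rho>: "0 < \<rho>" "\<rho> \<le> 1" using w by (auto simp: \<rho>_def abs_square_less_1 power_less_one_iff)
  \<comment> \<open>The 32 rounds up 4 + 16, the constants that bound \<rho>^2 and (x - a - j)^2 by
    the squared denominator.\<close>
  define c where "c = (4 / \<rho>) powr (q - 1) * 32"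
  define J :: "real set" where "J = {- 2 * pi, 0, 2 * pi}"
  have J: "finite J" "card J = 3" by (auto simp: J_def)
  define g where "g x = (\<Sum>j\<in>J. c * (\<rho> / (\<rho>\<^sup>2 + (x - a - j)\<^sup>2)))" for x
  \<comment> \<open>Each summand of \<open>g\<close> is a multiple of a Cauchy density, so an
    arctangent integrates it and its total mass is at most c pi.\<close>
  define G where "G x = (\<Sum>j\<in>J. c * arctan ((x - a - j) / \<rho>))" for x
  have c: "0 \<le> c" by (simp add: c_def)
  have le: "poisson w x powr q \<le> g x" if "x \<in> {- pi<..pi}" for x
  proof -
    have D: "\<rho> / 2 \<le> cmod (1 + cis x * w)"
      using kernel_denominator_ge(1)[of "cmod w" "x - a"] w a(3)[of x] by (simp add: \<rho>_def)
    have "\<exists>j\<in>J. \<bar>x - a - j\<bar> \<le> pi" using that a by (auto simp: J_def)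
    then obtain j where j: "j \<in> J" "\<bar>x - a - j\<bar> \<le> pi" by blast
    have "cis j = 1" using j(1) by (auto simp: J_def complex_eq_iff)
    then have "cis (x - a - j) = cis (x - a)" by (simp flip: cis_divide)
    then have D2: "\<bar>x - a - j\<bar> / 4 \<le> cmod (1 + cis x * w)"
      using kernel_denominator_ge(2)[of "cmod w" "x - a - j"] w j a(3)[of x] by simp
    have Dpos: "0 < cmod (1 + cis x * w)" using D \<rho> by linarith
    have "(\<rho> / 2)\<^sup>2 \<le> (cmod (1 + cis x * w))\<^sup>2"
      using D \<rho> by (intro power_mono) auto
    moreover have "(\<bar>x - a - j\<bar> / 4)\<^sup>2 \<le> (cmod (1 + cis x * w))\<^sup>2"
      using D2 by (intro power_mono) auto
    ultimately have "\<rho>\<^sup>2 \<le> 4 * (cmod (1 + cis x * w))\<^sup>2"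
      "(x - a - j)\<^sup>2 \<le> 16 * (cmod (1 + cis x * w))\<^sup>2" by (simp_all add: power_divide)
    then have "\<rho>\<^sup>2 + (x - a - j)\<^sup>2 \<le> 4 * (cmod (1 + cis x * w))\<^sup>2 + 16 * (cmod (1 + cis x * w))\<^sup>2"
      by (rule add_mono)
    also have "\<dots> \<le> 32 * (cmod (1 + cis x * w))\<^sup>2" by simp
    finally have sq: "(\<rho>\<^sup>2 + (x - a - j)\<^sup>2) / 32 \<le> (cmod (1 + cis x * w))\<^sup>2" by simp
    have pos: "0 < \<rho>\<^sup>2 + (x - a - j)\<^sup>2" using \<rho> by (simp add: add_pos_nonneg)
    have p0: "0 \<le> poisson w x" using \<rho> by (simp add: poisson_def \<rho>_def)
    have "poisson w x \<le> \<rho> / (\<rho> / 2)\<^sup>2" unfolding poisson_def \<rho>_def[symmetric]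
      using D \<rho> Dpos by (intro divide_left_mono power_mono) auto
    then have p1: "poisson w x \<le> 4 / \<rho>" using \<rho> by (simp add: power2_eq_square)
    have "poisson w x \<le> \<rho> / ((\<rho>\<^sup>2 + (x - a - j)\<^sup>2) / 32)" unfolding poisson_def \<rho>_def[symmetric]
      using sq \<rho> Dpos pos by (intro divide_left_mono) auto
    then have p2: "poisson w x \<le> 32 * (\<rho> / (\<rho>\<^sup>2 + (x - a - j)\<^sup>2))"
      by (simp add: mult.commute[of \<rho> 32])
    have "poisson w x powr q = poisson w x powr (q - 1) * poisson w x"
      using p0 by (cases "poisson w x = 0") (simp_all add: powr_diff)
    also have "\<dots> \<le> (4 / \<rho>) powr (q - 1) * (32 * (\<rho> / (\<rho>\<^sup>2 + (x - a - j)\<^sup>2)))"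
      using p0 p1 p2 q by (intro mult_mono powr_mono2) auto
    also have "\<dots> = c * (\<rho> / (\<rho>\<^sup>2 + (x - a - j)\<^sup>2))" by (simp add: c_def)
    also have "\<dots> \<le> g x" unfolding g_def
      using j(1) c \<rho> J by (intro member_le_sum) auto
    finally show ?thesis .
  qed
  have "(\<integral>\<^sup>+ x. ennreal (poisson w x powr q) * indicator {- pi<..pi} x \<partial>lborel)
      \<le> (\<integral>\<^sup>+ x. ennreal (g x) * indicator {- pi..pi} x \<partial>lborel)"
    using le by (intro nn_integral_mono) (auto simp: indicator_def intro!: ennreal_leI)
  also have "\<dots> = ennreal (G pi - G (- pi))"
  proof (rule nn_integral_FTC_Icc)
    show "g \<in> borel_measurable borel" unfolding g_def by measurable
    show "(G has_real_derivative g x) (at x)" for x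
    proof -
      have "((\<lambda>x. c * arctan ((x - a - j) / \<rho>)) has_real_derivative c * (\<rho> / (\<rho>\<^sup>2 + (x - a - j)\<^sup>2))) (at x)" for j
      proof -
        have "1 + ((x - a - j) / \<rho>)\<^sup>2 = (\<rho>\<^sup>2 + (x - a - j)\<^sup>2) / \<rho>\<^sup>2"
          using \<rho> by (simp add: power_divide add_divide_distrib)
        then have e: "inverse (1 + ((x - a - j) / \<rho>)\<^sup>2) * (1 / \<rho>) = \<rho> / (\<rho>\<^sup>2 + (x - a - j)\<^sup>2)"
          using \<rho> by (simp add: power2_eq_square)
        have "((\<lambda>x. (x - a - j) / \<rho>) has_real_derivative 1 / \<rho>) (at x)"
          using \<rho> by (auto intro!: derivative_eq_intros)
        from DERIV_cmult[OF DERIV_chain2[OF DERIV_arctan this], of c]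
        show ?thesis unfolding e .
      qed
      then show ?thesis unfolding G_def g_def by (intro DERIV_sum)
    qed
    show "0 \<le> g x" for x unfolding g_def using c \<rho> by (intro sum_nonneg) auto
  qed simp
  also have "\<dots> \<le> ennreal (4 powr (q - 1) * 96 * pi * \<rho> powr (1 - q))"
  proof (rule ennreal_leI)
    have "G pi - G (- pi) = (\<Sum>j\<in>J. c * (arctan ((pi - a - j) / \<rho>) - arctan ((- pi - a - j) / \<rho>)))"
      by (simp add: G_def sum_subtractf right_diff_distrib)
    also have "\<dots> \<le> (\<Sum>j\<in>J. c * pi)"
    proof (intro sum_mono mult_left_mono c)
      show "arctan x - arctan y \<le> pi" for x y
        using arctan_bounded[of x] arctan_bounded[of y] by linarith
    qed
    \<comment> \<open>96 is the number 3 of translates times the 32 in \<open>c\<close>.\<close>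
    also have "\<dots> = 4 powr (q - 1) * 96 * pi * \<rho> powr (1 - q)"
    proof -
      have "(4 / \<rho>) powr (q - 1) = 4 powr (q - 1) * \<rho> powr (1 - q)"
        using \<rho> powr_minus_divide[of \<rho> "q - 1"] by (simp add: powr_divide)
      then show ?thesis using J by (simp add: c_def)
    qed
    finally show "G pi - G (- pi) \<le> 4 powr (q - 1) * 96 * pi * \<rho> powr (1 - q)" .
  qed
  finally show ?thesis by (simp add: \<rho>_def)
qed

text \<open>Triples nest to the right, but the kernel estimate needs z3 innermost with the other two
  angles as a pair; integrating one angle at a time allows the regrouping.\<close>

lemma nn_integral_lborel_triple:
  fixes f :: "real \<times> real \<times> real \<Rightarrow> ennreal"
  assumes f: "f \<in> borel_measurable borel"
  shows "(\<integral>\<^sup>+ t. f t \<partial>lborel) = (\<integral>\<^sup>+ p. (\<integral>\<^sup>+ x. f (fst p, snd p, x) \<partial>lborel) \<partial>lborel)"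
proof -
  have f': "f \<in> borel_measurable (lborel \<Otimes>\<^sub>M lborel)"
    using f by (simp add: lborel_prod)
  have f1: "(\<lambda>p. f (t, p)) \<in> borel_measurable (lborel \<Otimes>\<^sub>M lborel)" for t
    using f by (auto simp: lborel_prod intro: measurable_compose[OF _ f])
  have assoc: "(\<lambda>q::(real \<times> real) \<times> real. (fst (fst q), snd (fst q), snd q)) \<in> borel \<rightarrow>\<^sub>M borel"
    by (intro borel_measurable_continuous_onI continuous_intros)
  have f2: "(\<lambda>(p, x). f (fst p, snd p, x)) \<in> borel_measurable (lborel \<Otimes>\<^sub>M lborel)"
    unfolding lborel_prod case_prod_beta using measurable_compose[OF assoc f] by simp
  have f3: "(\<lambda>p. \<integral>\<^sup>+ x. f (fst p, snd p, x) \<partial>lborel) \<in> borel_measurable (lborel \<Otimes>\<^sub>M lborel)"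
    using lborel.borel_measurable_nn_integral[OF f2] by (simp add: lborel_prod)
  have "(\<integral>\<^sup>+ t. f t \<partial>lborel) = (\<integral>\<^sup>+ t. (\<integral>\<^sup>+ p. f (t, p) \<partial>lborel) \<partial>lborel)"
    using lborel.nn_integral_fst[OF f'] by (simp add: lborel_prod)
  also have "\<dots> = (\<integral>\<^sup>+ t. (\<integral>\<^sup>+ s. \<integral>\<^sup>+ x. f (t, s, x) \<partial>lborel \<partial>lborel) \<partial>lborel)"
    using lborel.nn_integral_fst[OF f1] by (simp add: lborel_prod)
  also have "\<dots> = (\<integral>\<^sup>+ p. (\<integral>\<^sup>+ x. f (fst p, snd p, x) \<partial>lborel) \<partial>lborel)"
    using lborel.nn_integral_fst[OF f3] by (simp add: lborel_prod)
  finally show ?thesis .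
qed

text \<open>The cylinder over a null set is null, since its indicator has zero integral after the
  regrouping.\<close>

lemma AE_lborel_triple:
  fixes N :: "(real \<times> real) set"
  assumes N: "N \<in> sets borel" and ae: "AE p in lborel. p \<notin> N"
  shows "AE t in (lborel :: (real \<times> real \<times> real) measure). (fst t, fst (snd t)) \<notin> N"
proof -
  define f :: "real \<times> real \<times> real \<Rightarrow> ennreal" where "f t = indicator N (fst t, fst (snd t))" for t
  have meas: "f \<in> borel_measurable borel" unfolding f_def
    by (rule measurable_compose[OF _ borel_measurable_indicator[OF N]])
      (auto intro!: borel_measurable_continuous_onI continuous_intros)
  have "(\<integral>\<^sup>+ t. f t \<partial>lborel) = (\<integral>\<^sup>+ p. (\<integral>\<^sup>+ x. f (fst p, snd p, x) \<partial>lborel) \<partial>lborel)"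
    by (rule nn_integral_lborel_triple[OF meas])
  also have "\<dots> = (\<integral>\<^sup>+ p. 0 \<partial>(lborel :: (real \<times> real) measure))"
    by (rule nn_integral_cong_AE) (use ae in \<open>auto simp: f_def elim!: eventually_mono\<close>)
  finally have "AE t in lborel. f t = 0"
    using nn_integral_0_iff_AE[of f lborel] meas by simp
  then show ?thesis by (auto simp: f_def indicator_def split: if_splits)
qed

text \<open>The two kernel estimates have constants depending on q only, so finiteness transfers in
  both directions. They need |w| < 1, hence hold for almost every p.\<close>

lemma poisson_Lp_iff:
  fixes w :: "real \<times> real \<Rightarrow> complex"
  assumes w: "continuous_on UNIV w" and lt: "AE p in lborel. cmod (w p) < 1"
    and B: "B \<in> sets borel" and q: "1 \<le> q"
  shows "(\<integral>\<^sup>+ t. ennreal (poisson (w (fst t, fst (snd t))) (snd (snd t)) powr q)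
        * indicator {t. (fst t, fst (snd t)) \<in> B \<and> snd (snd t) \<in> {- pi<..pi}} t \<partial>lborel) < \<infinity>
    \<longleftrightarrow> (\<integral>\<^sup>+ p. ennreal ((1 - (cmod (w p))\<^sup>2) powr (1 - q)) * indicator B p \<partial>lborel) < \<infinity>"
    (is "?L < \<infinity> \<longleftrightarrow> ?R < \<infinity>")
proof -
  have wm[measurable]: "w \<in> borel_measurable borel"
    by (rule borel_measurable_continuous_onI[OF w])
  note B[measurable]
  have cism[measurable]: "cis \<in> borel_measurable borel"
    by (intro borel_measurable_continuous_onI continuous_intros)
  define I where "I p = (\<integral>\<^sup>+ x. ennreal (poisson (w p) x powr q) * indicator {- pi<..pi} x \<partial>lborel)" for p
  have proj[measurable]: "(\<lambda>t::real \<times> real \<times> real. (fst t, fst (snd t))) \<in> borel_measurable borel"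
    "(\<lambda>t::real \<times> real \<times> real. snd (snd t)) \<in> borel_measurable borel"
    by (auto intro!: borel_measurable_continuous_onI continuous_intros)
  have up1: "I p * indicator B p \<le> ennreal (4 powr (q - 1) * 96 * pi) * (ennreal ((1 - (cmod (w p))\<^sup>2) powr (1 - q)) * indicator B p)"
    if "cmod (w p) < 1" for p
    using poisson_powr_integral_le[OF that q]
    by (auto simp: I_def indicator_def ennreal_mult[symmetric])
  have lo1: "ennreal (4 powr (- q)) * (ennreal ((1 - (cmod (w p))\<^sup>2) powr (1 - q)) * indicator B p) \<le> I p * indicator B p"
    if "cmod (w p) < 1" for p
    using poisson_powr_integral_ge[OF that q]
    by (auto simp: I_def indicator_def ennreal_mult[symmetric])
  have "?L = (\<integral>\<^sup>+ p. I p * indicator B p \<partial>lborel)"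
  proof (subst nn_integral_lborel_triple)
    show "(\<lambda>t. ennreal (poisson (w (fst t, fst (snd t))) (snd (snd t)) powr q)
        * indicator {t. (fst t, fst (snd t)) \<in> B \<and> snd (snd t) \<in> {- pi<..pi}} t) \<in> borel_measurable borel"
      unfolding poisson_def by measurable
    have "(\<integral>\<^sup>+ x. ennreal (poisson (w p) x powr q)
        * indicator {t. (fst t, fst (snd t)) \<in> B \<and> snd (snd t) \<in> {- pi<..pi}} (fst p, snd p, x) \<partial>lborel)
      = I p * indicator B p" for p
      by (cases "p \<in> B") (auto simp: I_def indicator_def cong: if_cong)
    then show "(\<integral>\<^sup>+ p. \<integral>\<^sup>+ x. ennreal (poisson (w (fst (fst p, snd p, x), fst (snd (fst p, snd p, x))))
          (snd (snd (fst p, snd p, x))) powr q)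
        * indicator {t. (fst t, fst (snd t)) \<in> B \<and> snd (snd t) \<in> {- pi<..pi}} (fst p, snd p, x) \<partial>lborel \<partial>lborel)
      = (\<integral>\<^sup>+ p. I p * indicator B p \<partial>lborel)" by simp
  qed
  moreover have "(\<integral>\<^sup>+ p. I p * indicator B p \<partial>lborel)
      \<le> (\<integral>\<^sup>+ p. ennreal (4 powr (q - 1) * 96 * pi) * (ennreal ((1 - (cmod (w p))\<^sup>2) powr (1 - q)) * indicator B p) \<partial>lborel)"
    by (rule nn_integral_mono_AE, rule eventually_mono[OF lt up1])
  moreover have "\<dots> = ennreal (4 powr (q - 1) * 96 * pi) * ?R"
    by (rule nn_integral_cmult) measurable
  moreover have "(\<integral>\<^sup>+ p. ennreal (4 powr (- q)) * (ennreal ((1 - (cmod (w p))\<^sup>2) powr (1 - q)) * indicator B p) \<partial>lborel)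
     \<le> (\<integral>\<^sup>+ p. I p * indicator B p \<partial>lborel)"
    by (rule nn_integral_mono_AE, rule eventually_mono[OF lt lo1])
  moreover have "(\<integral>\<^sup>+ p. ennreal (4 powr (- q)) * (ennreal ((1 - (cmod (w p))\<^sup>2) powr (1 - q)) * indicator B p) \<partial>lborel)
     = ennreal (4 powr (- q)) * ?R"
    by (rule nn_integral_cmult) measurable
  ultimately have up: "?L \<le> ennreal (4 powr (q - 1) * 96 * pi) * ?R" and lo: "ennreal (4 powr (- q)) * ?R \<le> ?L"
    by simp_all
  show ?thesis
  proof
    assume "?L < \<infinity>"
    with lo have "ennreal (4 powr (- q)) * ?R < top" by (simp add: le_less_trans)
    then show "?R < \<infinity>" by (auto simp: ennreal_mult_less_top)
  next
    assume "?R < \<infinity>"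
    then have "ennreal (4 powr (q - 1) * 96 * pi) * ?R < top" by (simp add: ennreal_mult_less_top)
    with up show "?L < \<infinity>" by (simp add: le_less_trans)
  qed
qed

subsection \<open>Integrals of negative powers near a zero\<close>

text \<open>Lets a cusp parametrised by the second angle be treated as one parametrised by the
  first.\<close>

lemma nn_integral_lborel_swap:
  fixes f :: "real \<times> real \<Rightarrow> ennreal"
  assumes [measurable]: "f \<in> borel_measurable borel"
  shows "(\<integral>\<^sup>+ p. f (prod.swap p) \<partial>lborel) = (\<integral>\<^sup>+ p. f p \<partial>lborel)"
proof -
  have f': "f \<in> borel_measurable (lborel \<Otimes>\<^sub>M lborel)" by (simp add: lborel_prod)
  have sw: "prod.swap \<in> borel \<rightarrow>\<^sub>M (borel :: (real \<times> real) measure)"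
    unfolding prod.swap_def by (intro borel_measurable_continuous_onI continuous_intros)
  have g': "(\<lambda>p. f (prod.swap p)) \<in> borel_measurable (lborel \<Otimes>\<^sub>M lborel)"
    using measurable_compose[OF sw, of f] by (simp add: lborel_prod)
  have "(\<integral>\<^sup>+ p. f (prod.swap p) \<partial>lborel) = (\<integral>\<^sup>+ s. \<integral>\<^sup>+ t. f (t, s) \<partial>lborel \<partial>lborel)"
    using lborel.nn_integral_fst[OF g'] by (simp add: lborel_prod)
  also have "\<dots> = (\<integral>\<^sup>+ p. f p \<partial>lborel)"
    using lborel_pair.nn_integral_snd[OF f'] by (simp add: lborel_prod)
  finally show ?thesis .
qed

lemma nn_integral_inverse_diverges:
  assumes "0 < c" "0 < \<delta>"
  shows "(\<integral>\<^sup>+ s. ennreal (c / s) * indicator {0<..<\<delta>} s \<partial>lborel) = \<infinity>"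
proof (rule ccontr)
  let ?I = "\<integral>\<^sup>+ s. ennreal (c / s) * indicator {0<..<\<delta>} s \<partial>lborel"
  assume "?I \<noteq> \<infinity>"
  then obtain M where M: "?I = ennreal M" "0 \<le> M" by (cases ?I) auto
  define d where "d = \<delta> / 2"
  \<comment> \<open>Chosen so that the integral of c/s from e to d is M + 1, one more than the
    supposed value.\<close>
  define e where "e = d * exp (- ((M + 1) / c))"
  have d: "0 < d" "d < \<delta>" using assms by (auto simp: d_def)
  have e: "0 < e" "e \<le> d" using d M assms by (auto simp: e_def mult_le_cancel_left1)
  have "ennreal (c * ln d - c * ln e) = (\<integral>\<^sup>+ s. ennreal (c / s) * indicator {e..d} s \<partial>lborel)"
    using e assms by (intro nn_integral_FTC_Icc[symmetric]) (auto intro!: derivative_eq_intros)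
  also have "\<dots> \<le> ?I"
    using d e by (intro nn_integral_mono) (auto simp: indicator_def)
  finally have "c * ln d - c * ln e \<le> M" using M by simp
  moreover have "ln e = ln d - (M + 1) / c" using d by (simp add: e_def ln_mult)
  ultimately show False using assms by (simp add: algebra_simps)
qed

text \<open>A cusp at the origin along the line x = \<beta> s. One side of the line is enough, as
  only lower bounds for integrals are drawn from it.\<close>

definition horn :: "real \<Rightarrow> real \<Rightarrow> real \<Rightarrow> (real \<times> real) set" where
  "horn \<beta> \<nu> \<delta> = {(s, x). 0 < s \<and> s < \<delta> \<and> \<beta> * s < x \<and> x < \<beta> * s + s powr \<nu>}"

lemma horn_sets[measurable]: "horn \<beta> \<nu> \<delta> \<in> sets borel"
proof -
  have "horn \<beta> \<nu> \<delta> = {p \<in> space borel. 0 < fst p \<and> fst p < \<delta> \<and> \<beta> * fst p < snd p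
      \<and> snd p < \<beta> * fst p + fst p powr \<nu>}"
    by (auto simp: horn_def)
  also have "\<dots> \<in> sets (borel \<Otimes>\<^sub>M borel)"
    unfolding borel_prod[symmetric] by measurable
  finally show ?thesis unfolding borel_prod .
qed

text \<open>The slice at s has length s^\<nu>, so it contributes c s^(\<nu> + \<kappa>), which is at
  least c/s for s \<le> 1.\<close>

lemma nn_integral_horn_diverges:
  assumes c: "0 < c" and \<delta>: "0 < \<delta>" "\<delta> \<le> 1" and \<kappa>: "\<nu> + \<kappa> \<le> - 1"
  shows "(\<integral>\<^sup>+ p. ennreal (c * fst p powr \<kappa>) * indicator (horn \<beta> \<nu> \<delta>) p \<partial>lborel) = \<infinity>"
proof -
  have "(\<integral>\<^sup>+ p. ennreal (c * fst p powr \<kappa>) * indicator (horn \<beta> \<nu> \<delta>) p \<partial>lborel)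
    = (\<integral>\<^sup>+ s. \<integral>\<^sup>+ x. ennreal (c * s powr \<kappa>) * indicator (horn \<beta> \<nu> \<delta>) (s, x) \<partial>lborel \<partial>lborel)"
  proof -
    have "(\<lambda>p. ennreal (c * fst p powr \<kappa>) * indicator (horn \<beta> \<nu> \<delta>) p) \<in> borel_measurable (lborel \<Otimes>\<^sub>M lborel)"
    proof -
      have [measurable]: "horn \<beta> \<nu> \<delta> \<in> sets (borel \<Otimes>\<^sub>M borel)" unfolding borel_prod by measurable
      show ?thesis by measurable
    qed
    from lborel.nn_integral_fst[OF this] show ?thesis by (simp add: lborel_prod)
  qed
  also have "\<dots> \<ge> (\<integral>\<^sup>+ s. ennreal (c / s) * indicator {0<..<\<delta>} s \<partial>lborel)"
  proof (rule nn_integral_mono)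
    fix s :: real
    show "ennreal (c / s) * indicator {0<..<\<delta>} s
      \<le> (\<integral>\<^sup>+ x. ennreal (c * s powr \<kappa>) * indicator (horn \<beta> \<nu> \<delta>) (s, x) \<partial>lborel)"
    proof (cases "s \<in> {0<..<\<delta>}")
      case True
      then have s: "0 < s" "s \<le> 1" using \<delta> by auto
      have "c / s = c * s powr (- 1)" using s by (simp add: powr_minus_divide)
      also have "\<dots> \<le> c * s powr (\<nu> + \<kappa>)"
        using s c \<kappa> by (intro mult_left_mono powr_mono') auto
      also have "\<dots> = c * s powr \<kappa> * s powr \<nu>" by (simp add: powr_add)
      finally have "ennreal (c / s) \<le> ennreal (c * s powr \<kappa>) * ennreal (s powr \<nu>)"
        using c by (simp add: ennreal_mult[symmetric] ennreal_leI)
      also have "\<dots> = (\<integral>\<^sup>+ x. ennreal (c * s powr \<kappa>) * indicator {\<beta> * s<..<\<beta> * s + s powr \<nu>} x \<partial>lborel)"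
        by (simp add: nn_integral_cmult_indicator)
      also have "\<dots> = (\<integral>\<^sup>+ x. ennreal (c * s powr \<kappa>) * indicator (horn \<beta> \<nu> \<delta>) (s, x) \<partial>lborel)"
        using True by (intro nn_integral_cong) (auto simp: horn_def indicator_def)
      finally show ?thesis using True by simp
    qed simp
  qed
  finally show ?thesis
    using nn_integral_inverse_diverges[OF c \<delta>(1)] by (simp add: top_unique)
qed

text \<open>If \<open>f\<close> is \<open>O(s\<^bsup>\<mu>\<^esup>)\<close> on a horn of width \<open>s\<^bsup>\<mu>/2\<^esup>\<close>, then integrating \<open>f\<^bsup>1-q\<^esup>\<close> over slices
  leaves \<open>s\<^bsup>\<mu>(1-q) + \<mu>/2\<^esup>\<close>, which is not integrable once the exponent is at most \<open>-1\<close>.\<close>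

lemma powr_integral_diverges:
  fixes f :: "real \<times> real \<Rightarrow> real" and \<sigma> :: "real \<times> real \<Rightarrow> real \<times> real"
  assumes pos: "AE p in lborel. 0 < f p" and K: "0 < K" and \<delta>: "0 < \<delta>" "\<delta> \<le> 1"
    and q: "1 \<le> q" "1 \<le> \<mu> * (q - 3 / 2)"
    and \<sigma>: "\<sigma> = (\<lambda>p. p) \<or> \<sigma> = prod.swap"
    and le: "\<And>s x. (s, x) \<in> horn \<beta> (\<mu> / 2) \<delta> \<Longrightarrow> \<sigma> (s, x) \<in> B \<and> f (\<sigma> (s, x)) \<le> K * s powr \<mu>"
  shows "(\<integral>\<^sup>+ p. ennreal (f p powr (1 - q)) * indicator B p \<partial>lborel) = \<infinity>"
proof -
  define c where "c = K powr (1 - q)"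
  define h where "h p = ennreal (c * fst p powr (\<mu> * (1 - q))) * indicator (horn \<beta> (\<mu> / 2) \<delta>) p" for p
  have hm: "h \<in> borel_measurable borel"
  proof -
    have [measurable]: "horn \<beta> (\<mu> / 2) \<delta> \<in> sets (borel \<Otimes>\<^sub>M borel)" unfolding borel_prod by measurable
    show ?thesis unfolding h_def borel_prod[symmetric] by measurable
  qed
  have \<sigma>\<sigma>: "\<sigma> (\<sigma> p) = p" for p using \<sigma> by auto
  \<comment> \<open>The hypothesis on q is \<mu>/2 + \<mu>(1 - q) \<le> -1 rearranged.\<close>
  have "\<infinity> = (\<integral>\<^sup>+ p. h p \<partial>lborel)" unfolding h_def
    by (rule nn_integral_horn_diverges[symmetric]) (use K \<delta> q in \<open>auto simp: c_def algebra_simps\<close>)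
  also have "\<dots> = (\<integral>\<^sup>+ p. h (\<sigma> p) \<partial>lborel)"
    using \<sigma> nn_integral_lborel_swap[OF hm] by auto
  \<comment> \<open>Zeros of f must be left out: there \<open>f p powr (1 - q)\<close> is 0, which
    would break the lower bound.\<close>
  also have "\<dots> \<le> (\<integral>\<^sup>+ p. ennreal (f p powr (1 - q)) * indicator B p \<partial>lborel)"
  proof (rule nn_integral_mono_AE, rule eventually_mono[OF pos])
    fix p assume f: "0 < f p"
    show "h (\<sigma> p) \<le> ennreal (f p powr (1 - q)) * indicator B p"
    proof (cases "\<sigma> p \<in> horn \<beta> (\<mu> / 2) \<delta>")
      case True
      obtain s x where sx: "\<sigma> p = (s, x)" by (cases "\<sigma> p")
      then have p: "p = \<sigma> (s, x)" using \<sigma>\<sigma>[of p] by simp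
      have le': "p \<in> B" "f p \<le> K * s powr \<mu>" using le[of s x] True sx p by auto
      have "c * s powr (\<mu> * (1 - q)) = (K * s powr \<mu>) powr (1 - q)"
        using K by (simp add: c_def powr_mult powr_powr)
      also have "\<dots> \<le> f p powr (1 - q)"
        using le' f q by (intro powr_mono2') auto
      finally show ?thesis using le' True sx by (simp add: h_def ennreal_leI)
    qed (simp add: h_def)
  qed
  finally show ?thesis by (simp add: top_unique)
qed

lemma nn_integral_abs_powr_finite:
  assumes e: "- 1 < e"
  shows "(\<integral>\<^sup>+ t. ennreal (\<bar>t\<bar> powr e) * indicator {- 1..1::real} t \<partial>lborel) < \<infinity>"
proof -
  have 1: "((\<lambda>t. \<bar>t\<bar> powr e) has_integral (1 / (e + 1))) {0..1}"
    using has_integral_powr_from_0[OF e, of 1]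
      has_integral_eq[of "{0..1}" "\<lambda>t. t powr e" "\<lambda>t. \<bar>t\<bar> powr e"] by simp
  then have "((\<lambda>t. \<bar>- t\<bar> powr e) has_integral (1 / (e + 1))) {- 1..- 0}"
    by (subst has_integral_reflect_real) simp
  then have 2: "((\<lambda>t. \<bar>t\<bar> powr e) has_integral (1 / (e + 1))) {- 1..0}" by simp
  have "((\<lambda>t. \<bar>t\<bar> powr e) has_integral (1 / (e + 1) + 1 / (e + 1))) {- 1..1}"
    by (rule has_integral_combine[OF _ _ 2 1]) auto
  from nn_integral_has_integral_lebesgue'[OF _ this] show ?thesis by simp
qed

text \<open>The lower bound is a product, so it separates the variables; each factor |t|^(1-q) is
  integrable near 0 because 1 - q > -1.\<close>

lemma powr_integral_converges:
  fixes f :: "real \<times> real \<Rightarrow> real"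
  assumes l: "0 < l" and q: "1 \<le> q" "q < 2" and B: "B \<subseteq> {- 1..1} \<times> {- 1..1}"
    and ge: "\<And>t s. (t, s) \<in> B \<Longrightarrow> l * (\<bar>t\<bar> * \<bar>s\<bar>) \<le> f (t, s)"
    and meas: "f \<in> borel_measurable borel" "B \<in> sets borel"
  shows "(\<integral>\<^sup>+ p. ennreal (f p powr (1 - q)) * indicator B p \<partial>lborel) < \<infinity>"
proof -
  define g where "g t = ennreal (\<bar>t\<bar> powr (1 - q)) * indicator {- 1..1::real} t" for t
  have [measurable]: "g \<in> borel_measurable borel" unfolding g_def by measurable
  have g: "(\<integral>\<^sup>+ t. g t \<partial>lborel) < \<infinity>" unfolding g_def
    by (rule nn_integral_abs_powr_finite) (use q in simp)
  have "(\<lambda>p. ennreal (f p powr (1 - q)) * indicator B p) \<in> borel_measurable (lborel \<Otimes>\<^sub>M lborel)"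
    using meas by (simp add: lborel_prod)
  from lborel.nn_integral_fst[OF this]
  have "(\<integral>\<^sup>+ p. ennreal (f p powr (1 - q)) * indicator B p \<partial>lborel)
    = (\<integral>\<^sup>+ t. \<integral>\<^sup>+ s. ennreal (f (t, s) powr (1 - q)) * indicator B (t, s) \<partial>lborel \<partial>lborel)"
    by (simp add: lborel_prod)
  \<comment> \<open>The axes are discarded because comparing nonpositive powers needs a positive
    base.\<close>
  also have "\<dots> \<le> (\<integral>\<^sup>+ t. \<integral>\<^sup>+ s. ennreal (l powr (1 - q)) * g t * g s \<partial>lborel \<partial>lborel)"
  proof (rule nn_integral_mono_AE, rule eventually_mono[OF AE_lborel_singleton[of 0]],
      rule nn_integral_mono_AE, rule eventually_mono[OF AE_lborel_singleton[of 0]])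
    fix t s :: real assume ts: "t \<noteq> 0" "s \<noteq> 0"
    show "ennreal (f (t, s) powr (1 - q)) * indicator B (t, s) \<le> ennreal (l powr (1 - q)) * g t * g s"
    proof (cases "(t, s) \<in> B")
      case True
      have "f (t, s) powr (1 - q) \<le> (l * (\<bar>t\<bar> * \<bar>s\<bar>)) powr (1 - q)"
        using ge[OF True] l ts q by (intro powr_mono2') auto
      also have "\<dots> = l powr (1 - q) * \<bar>t\<bar> powr (1 - q) * \<bar>s\<bar> powr (1 - q)"
        using l by (simp add: powr_mult)
      finally show ?thesis using True B
        by (auto simp: g_def ennreal_mult[symmetric] intro!: ennreal_leI)
    qed simp
  qed
  also have "\<dots> = (\<integral>\<^sup>+ t. ennreal (l powr (1 - q)) * g t * (\<integral>\<^sup>+ s. g s \<partial>lborel) \<partial>lborel)"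
    by (intro nn_integral_cong nn_integral_cmult) measurable
  also have "\<dots> = ennreal (l powr (1 - q)) * (\<integral>\<^sup>+ t. g t \<partial>lborel) * (\<integral>\<^sup>+ s. g s \<partial>lborel)"
    by (simp add: nn_integral_multc nn_integral_cmult)
  also have "\<dots> < \<infinity>" using g by (simp add: ennreal_mult_less_top)
  finally show ?thesis .
qed

text \<open>For the symmetric matrix M of the form, Cayley-Hamilton gives tr(M) M - det(M) I = M^2.
  Applied to v = (t,s) and paired with v, the right-hand side becomes |Mv|^2, the two squares in the
  proof.\<close>

lemma quadratic_form_ge:
  fixes A B C t s :: real
  assumes "0 < A + C"
  shows "(A * C - B\<^sup>2 / 4) / (A + C) * (t\<^sup>2 + s\<^sup>2) \<le> A * t\<^sup>2 + B * t * s + C * s\<^sup>2"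
proof -
  have "(A + C) * (A * t\<^sup>2 + B * t * s + C * s\<^sup>2) - (A * C - B\<^sup>2 / 4) * (t\<^sup>2 + s\<^sup>2)
    = (A * t + B / 2 * s)\<^sup>2 + (B / 2 * t + C * s)\<^sup>2"
    by (simp add: power2_eq_square algebra_simps)
  also have "\<dots> \<ge> 0" by simp
  finally have "(A * C - B\<^sup>2 / 4) * (t\<^sup>2 + s\<^sup>2) \<le> (A + C) * (A * t\<^sup>2 + B * t * s + C * s\<^sup>2)" by simp
  then show ?thesis using assms by (simp add: field_simps)
qed

text \<open>Along a ray the form scales like u^2 and the remainder like u^3, so a negative value of
  the form would make f negative for small u.\<close>

lemma quadratic_form_nonneg_if_cubic_remainder:
  fixes f :: "real \<Rightarrow> real \<Rightarrow> real"
  assumes nonneg: "\<And>t s. 0 \<le> f t s"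
    and taylor: "\<And>t s. \<bar>t\<bar> \<le> 1 \<Longrightarrow> \<bar>s\<bar> \<le> 1 \<Longrightarrow>
      \<bar>f t s - (A * t\<^sup>2 + B * t * s + C * s\<^sup>2)\<bar> \<le> K * (\<bar>t\<bar> + \<bar>s\<bar>) ^ 3"
  shows "0 \<le> A * t\<^sup>2 + B * t * s + C * s\<^sup>2"
proof (rule ccontr)
  define Q where "Q = A * t\<^sup>2 + B * t * s + C * s\<^sup>2"
  assume "\<not> 0 \<le> A * t\<^sup>2 + B * t * s + C * s\<^sup>2"
  then have Q: "Q < 0" by (simp add: Q_def)
  have lim: "((\<lambda>u. K * u * (\<bar>t\<bar> + \<bar>s\<bar>) ^ 3) \<longlongrightarrow> K * 0 * (\<bar>t\<bar> + \<bar>s\<bar>) ^ 3) (at_right 0)"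
    "((\<lambda>u. u * \<bar>t\<bar>) \<longlongrightarrow> 0 * \<bar>t\<bar>) (at_right 0)" "((\<lambda>u. u * \<bar>s\<bar>) \<longlongrightarrow> 0 * \<bar>s\<bar>) (at_right 0)"
    by (intro tendsto_intros)+
  then have "\<forall>\<^sub>F u in at_right 0. K * u * (\<bar>t\<bar> + \<bar>s\<bar>) ^ 3 < - Q"
    "\<forall>\<^sub>F u in at_right 0. u * \<bar>t\<bar> < 1" "\<forall>\<^sub>F u in at_right 0. u * \<bar>s\<bar> < 1"
    using Q order_tendstoD(2)[OF lim(1), of "- Q"] order_tendstoD(2)[OF lim(2), of 1]
      order_tendstoD(2)[OF lim(3), of 1] by simp_all
  moreover have "\<forall>\<^sub>F u in at_right (0::real). 0 < u" by (simp add: eventually_at_right_less)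
  ultimately have "\<forall>\<^sub>F u in at_right 0. 0 < u \<and> K * u * (\<bar>t\<bar> + \<bar>s\<bar>) ^ 3 < - Q \<and> u * \<bar>t\<bar> < 1 \<and> u * \<bar>s\<bar> < 1"
    by eventually_elim auto
  then obtain u where u: "0 < u" "K * u * (\<bar>t\<bar> + \<bar>s\<bar>) ^ 3 < - Q" "u * \<bar>t\<bar> < 1" "u * \<bar>s\<bar> < 1"
    using eventually_happens'[OF trivial_limit_at_right_real] by blast
  have "\<bar>f (u * t) (u * s) - (A * (u * t)\<^sup>2 + B * (u * t) * (u * s) + C * (u * s)\<^sup>2)\<bar> \<le> K * (\<bar>u * t\<bar> + \<bar>u * s\<bar>) ^ 3"
    by (rule taylor) (use u in \<open>auto simp: abs_mult\<close>)
  moreover have "A * (u * t)\<^sup>2 + B * (u * t) * (u * s) + C * (u * s)\<^sup>2 = u\<^sup>2 * Q"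
    by (simp add: Q_def power2_eq_square algebra_simps)
  moreover have "K * (\<bar>u * t\<bar> + \<bar>u * s\<bar>) ^ 3 = u\<^sup>2 * (K * u * (\<bar>t\<bar> + \<bar>s\<bar>) ^ 3)"
  proof -
    have "\<bar>u * t\<bar> + \<bar>u * s\<bar> = u * (\<bar>t\<bar> + \<bar>s\<bar>)" using u by (simp add: abs_mult algebra_simps)
    then show ?thesis by (simp add: power_mult_distrib power2_eq_square power3_eq_cube)
  qed
  moreover have "u\<^sup>2 * (K * u * (\<bar>t\<bar> + \<bar>s\<bar>) ^ 3) < u\<^sup>2 * (- Q)"
    using u by (intro mult_strict_left_mono) auto
  ultimately show False using nonneg[of "u * t" "u * s"] by linarith
qed

lemma discriminant_le_0_if_nonneg:
  fixes A B C :: real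
  assumes "\<And>t s. 0 \<le> A * t\<^sup>2 + B * t * s + C * s\<^sup>2"
  shows "0 \<le> A" "0 \<le> C" "B\<^sup>2 \<le> 4 * A * C"
proof -
  show A: "0 \<le> A" using assms[of 1 0] by simp
  show "0 \<le> C" using assms[of 0 1] by simp
  show "B\<^sup>2 \<le> 4 * A * C"
  proof (cases "A = 0")
    case True
    \<comment> \<open>If B were nonzero, the form would take the value -1 at this point.\<close>
    have "0 \<le> A * (- (C + 1) / B)\<^sup>2 + B * (- (C + 1) / B) * 1 + C * 1\<^sup>2" by (rule assms)
    then show ?thesis using True by (cases "B = 0") auto
  next
    case False
    \<comment> \<open>For fixed s = 2A the form is minimal at t = -B.\<close>
    have "0 \<le> A * (- B)\<^sup>2 + B * (- B) * (2 * A) + C * (2 * A)\<^sup>2" by (rule assms)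
    also have "\<dots> = A * (4 * A * C - B\<^sup>2)" by (simp add: power2_eq_square algebra_simps)
    finally show ?thesis using A False by (simp add: zero_le_mult_iff)
  qed
qed

subsection \<open>The derivative on the torus\<close>

text \<open>On the unit circle z^(m-i) is z^m times the conjugate of z^i.\<close>

lemma ev_reflection_on_torus:
  "ev (coeff_poly (\<lambda>i j. cnj (c (m - i) (n - j))) m n) (cis t) (cis s)
    = cis t ^ m * cis s ^ n * cnj (ev (coeff_poly c m n) (cis t) (cis s))"
proof -
  have 1: "cis x ^ (m - i) = cis x ^ m * cnj (cis x ^ i)" if "i \<le> m" for x :: real and i m :: nat
  proof -
    have "cis x ^ m = cis x ^ (m - i) * cis x ^ i" using that by (simp add: power_add[symmetric])
    moreover have "cis x ^ i * cnj (cis x ^ i) = 1"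
      by (simp add: cis_cnj cis_mult flip: power_mult_distrib)
    ultimately show ?thesis by (simp add: mult.assoc)
  qed
  have "ev (coeff_poly (\<lambda>i j. cnj (c (m - i) (n - j))) m n) (cis t) (cis s)
    = (\<Sum>i\<le>m. \<Sum>j\<le>n. cnj (c i j) * cis t ^ (m - i) * cis s ^ (n - j))"
    by (rule ev_coeff_poly_rev[of "\<lambda>i j. cnj (c i j)"])
  also have "\<dots> = (\<Sum>i\<le>m. \<Sum>j\<le>n. cis t ^ m * cis s ^ n * cnj (c i j * cis t ^ i * cis s ^ j))"
    by (intro sum.cong refl) (simp add: 1 mult_ac)
  also have "\<dots> = cis t ^ m * cis s ^ n * cnj (ev (coeff_poly c m n) (cis t) (cis s))"
    by (simp add: ev_coeff_poly sum_distrib_left)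
  finally show ?thesis .
qed

lemma Y_on_torus:
  "ev (Y1 a m n) (cis t) (cis s) = cis t ^ m * cis s ^ n * cnj (ev (X1 a m n) (cis t) (cis s))"
  "ev (Y2 a m n) (cis t) (cis s) = cis t ^ m * cis s ^ n * cnj (ev (X2 a m n) (cis t) (cis s))"
  using ev_reflection_on_torus[of "\<lambda>i j. a i j 0" m n t s]
    ev_reflection_on_torus[of "\<lambda>i j. a i j (Suc 0)" m n t s] by simp_all

lemma jac_on_torus:
  "ev (jac a m n) (cis t) (cis s) = cis t ^ m * cis s ^ n *
    of_real ((cmod (ev (X1 a m n) (cis t) (cis s)))\<^sup>2 - (cmod (ev (X2 a m n) (cis t) (cis s)))\<^sup>2)"
  unfolding jac_def ev_simps Y_on_torus of_real_diff complex_norm_square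
  by (simp add: algebra_simps)

definition ratio :: "(nat \<Rightarrow> nat \<Rightarrow> nat \<Rightarrow> complex) \<Rightarrow> nat \<Rightarrow> nat \<Rightarrow> real \<times> real \<Rightarrow> complex" where
  "ratio a m n p = ev (X2 a m n) (cis (fst p)) (cis (snd p)) / ev (X1 a m n) (cis (fst p)) (cis (snd p))"

text \<open>Reflection changes a value on the torus only by conjugation and a unimodular factor, so
  \<psi>^0 and p_2/p_1 have equal modulus there.\<close>

lemma rho_ratio: "rho a m n t s = 1 - (cmod (ratio a m n (t, s)))\<^sup>2"
  unfolding rho_def ratio_def Ptil1_ev Ptil2_ev Y_on_torus
  by (simp add: norm_mult norm_divide norm_power)

text \<open>If |p_2| > |p_1| at a point of the bidisc, then z3 = -p_1/p_2 gives a zero of p in the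
  tridisc. Radial limits carry the inequality to the torus.\<close>

lemma X2_le_X1:
  assumes rif: "RIF a m n"
  shows "cmod (ev (X2 a m n) (cis t) (cis s)) \<le> cmod (ev (X1 a m n) (cis t) (cis s))"
proof -
  define h where "h r = cmod (ev (X1 a m n) (of_real r * cis t) (of_real r * cis s))
    - cmod (ev (X2 a m n) (of_real r * cis t) (of_real r * cis s))" for r
  have inner: "cmod (ev (X2 a m n) z1 z2) \<le> cmod (ev (X1 a m n) z1 z2)"
    if "z1 \<in> disc" "z2 \<in> disc" for z1 z2
  proof (rule ccontr)
    assume *: "\<not> ?thesis"
    then have nz: "ev (X2 a m n) z1 z2 \<noteq> 0" by auto
    define z3 where "z3 = - ev (X1 a m n) z1 z2 / ev (X2 a m n) z1 z2"
    have "z3 \<in> disc" using * nz by (simp add: z3_def norm_divide)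
    moreover have "P a m n (z1, z2, z3) = 0" using nz by (simp add: P_ev z3_def)
    ultimately show False using rif that unfolding RIF_def by blast
  qed
  have "continuous_on UNIV h" unfolding h_def
    by (intro continuous_on_diff continuous_on_norm continuous_on_ev continuous_intros)
  then have "isCont h 1" by (simp add: continuous_on_eq_continuous_at)
  then have "(h \<longlongrightarrow> h 1) (at_left 1)"
    unfolding isCont_def by (rule filterlim_mono) (auto simp: at_le)
  moreover have "\<forall>\<^sub>F r in at_left 1. 0 \<le> h r"
  proof -
    have "\<forall>\<^sub>F r in at_left (1::real). r \<in> {0<..<1}" by (rule eventually_at_left_real) simp
    then show ?thesis
      by eventually_elim (auto simp: h_def norm_mult intro!: inner)
  qed
  ultimately have "0 \<le> h 1"
    by (rule tendsto_lowerbound) simp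
  then show ?thesis by (simp add: h_def)
qed

text \<open>A zero of p_1 on the torus would be a zero of p_2 by the previous inequality, hence of
  both reflections, and the reflection of p would vanish on a vertical line.\<close>

lemma X1_nonzero_on_torus:
  assumes rif: "RIF a m n"
    and novert: "\<not> (\<exists>z1\<in>circ. \<exists>z2\<in>circ. \<forall>z3\<in>circ. Ptil a m n (z1, z2, z3) = 0)"
  shows "ev (X1 a m n) (cis t) (cis s) \<noteq> 0"
proof
  assume 1: "ev (X1 a m n) (cis t) (cis s) = 0"
  then have 2: "ev (X2 a m n) (cis t) (cis s) = 0" using X2_le_X1[OF rif, of t s] by simp
  have "\<forall>z3\<in>circ. Ptil a m n (cis t, cis s, z3) = 0"
    by (simp add: Ptil_ev Y_on_torus 1 2)
  moreover have "cis t \<in> circ" "cis s \<in> circ" by auto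
  ultimately show False using novert by blast
qed

text \<open>As |p_2| < |p_1|, the denominator has no zero on the circle and the quotient rule
  applies; the z3-terms of its numerator cancel.\<close>

lemma dphi3_on_torus:
  assumes nz: "ev (X1 a m n) (cis t) (cis s) \<noteq> 0" and lt: "cmod (ratio a m n (t, s)) < 1"
  shows "dphi3 a m n (cis t, cis s, cis x) = ev (jac a m n) (cis t) (cis s) / (P a m n (cis t, cis s, cis x))\<^sup>2"
    and "cmod (dphi3 a m n (cis t, cis s, cis x)) = poisson (ratio a m n (t, s)) x"
proof -
  define x1 x2 y1 y2 where "x1 = ev (X1 a m n) (cis t) (cis s)" and "x2 = ev (X2 a m n) (cis t) (cis s)"
    and "y1 = ev (Y1 a m n) (cis t) (cis s)" and "y2 = ev (Y2 a m n) (cis t) (cis s)"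
  have x1: "x1 \<noteq> 0" using nz by (simp add: x1_def)
  have w: "ratio a m n (t, s) = x2 / x1" by (simp add: ratio_def x1_def x2_def)
  then have "cmod x2 < cmod x1" using lt x1 by (simp add: norm_divide)
  then have P: "x1 + cis x * x2 \<noteq> 0"
    by (metis add_eq_0_iff norm_cis norm_minus_cancel norm_mult mult_1 less_irrefl)
  have "((\<lambda>z. (z * y1 + y2) / (x1 + z * x2)) has_field_derivative
      (y1 * (x1 + cis x * x2) - (cis x * y1 + y2) * x2) / ((x1 + cis x * x2) * (x1 + cis x * x2))) (at (cis x))"
    by (rule DERIV_divide) (use P in \<open>auto intro!: derivative_eq_intros\<close>)
  then have "dphi3 a m n (cis t, cis s, cis x)
      = (y1 * (x1 + cis x * x2) - (cis x * y1 + y2) * x2) / ((x1 + cis x * x2) * (x1 + cis x * x2))"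
    unfolding dphi3_def phi_def
    by (simp add: Ptil_ev P_ev x1_def x2_def y1_def y2_def DERIV_imp_deriv)
  also have "\<dots> = (x1 * y1 - x2 * y2) / (x1 + cis x * x2)\<^sup>2"
    by (simp add: power2_eq_square algebra_simps)
  finally have eq: "dphi3 a m n (cis t, cis s, cis x) = (x1 * y1 - x2 * y2) / (x1 + cis x * x2)\<^sup>2" .
  then show eq': "dphi3 a m n (cis t, cis s, cis x)
      = ev (jac a m n) (cis t) (cis s) / (P a m n (cis t, cis s, cis x))\<^sup>2"
    by (simp add: P_ev jac_def x1_def x2_def y1_def y2_def)
  have "cmod (dphi3 a m n (cis t, cis s, cis x)) = \<bar>(cmod x1)\<^sup>2 - (cmod x2)\<^sup>2\<bar> / (cmod (x1 + cis x * x2))\<^sup>2"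
    unfolding eq' jac_on_torus x1_def[symmetric] x2_def[symmetric]
    by (simp add: P_ev norm_divide norm_mult norm_power x1_def x2_def del: of_real_diff)
  also have "\<dots> = ((cmod x1)\<^sup>2 - (cmod x2)\<^sup>2) / (cmod (x1 + cis x * x2))\<^sup>2"
    using \<open>cmod x2 < cmod x1\<close> by (simp add: power_mono)
  also have "\<dots> = poisson (x2 / x1) x"
  proof -
    have "x1 + cis x * x2 = x1 * (1 + cis x * (x2 / x1))" using x1 by (simp add: field_simps)
    then have "cmod (x1 + cis x * x2) = cmod x1 * cmod (1 + cis x * (x2 / x1))" by (metis norm_mult)
    moreover have "(cmod x1)\<^sup>2 - (cmod x2)\<^sup>2 = (cmod x1)\<^sup>2 * (1 - (cmod (x2 / x1))\<^sup>2)"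
      using x1 by (simp add: norm_divide power_divide field_simps)
    ultimately show ?thesis using x1 by (simp add: poisson_def power_mult_distrib)
  qed
  finally show "cmod (dphi3 a m n (cis t, cis s, cis x)) = poisson (ratio a m n (t, s)) x"
    by (simp add: w)
qed

section \<open>Boxes around (1,1) on the torus and in angles\<close>

definition torus_box :: "real \<Rightarrow> (complex \<times> complex) set" where
  "torus_box \<epsilon> = {(z1, z2). z1 \<in> circ \<and> z2 \<in> circ \<and> cmod (z1 - 1) < \<epsilon> \<and> cmod (z2 - 1) < \<epsilon>}"

definition angle_box :: "real \<Rightarrow> (real \<times> real) set" where
  "angle_box \<epsilon> = {(t, s). t \<in> {- pi<..pi} \<and> s \<in> {- pi<..pi} \<and> cmod (cis t - 1) < \<epsilon> \<and> cmod (cis s - 1) < \<epsilon>}"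

lemma nbhd_T2_torus_box:
  assumes "0 < \<epsilon>"
  shows "nbhd_T2 (torus_box \<epsilon>)"
proof -
  have "torus_box \<epsilon> = (circ \<times> circ) \<inter> (ball 1 \<epsilon> \<times> ball 1 \<epsilon>)"
    by (auto simp: torus_box_def dist_norm norm_minus_commute)
  moreover have "open (ball (1::complex) \<epsilon> \<times> ball (1::complex) \<epsilon>)" by (intro open_Times) auto
  ultimately have "openin (top_of_set (circ \<times> circ)) (torus_box \<epsilon>)"
    by (metis openin_open_Int)
  then show ?thesis using assms unfolding nbhd_T2_def
    by (intro conjI exI[of _ "torus_box \<epsilon>"]) (auto simp: torus_box_def)
qed

lemma angles_torus_box:
  "angles (torus_box \<epsilon>) = {t. (fst t, fst (snd t)) \<in> angle_box \<epsilon> \<and> snd (snd t) \<in> {- pi<..pi}}"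
  by (auto simp: angles_def torus_box_def angle_box_def)

lemma cis_borel_measurable: "cis \<in> borel_measurable borel"
  by (intro borel_measurable_continuous_onI continuous_intros)

lemma angle_box_sets: "angle_box \<epsilon> \<in> sets borel"
proof -
  note cis_borel_measurable[measurable]
  have "angle_box \<epsilon> = {p \<in> space borel. fst p \<in> {- pi<..pi} \<and> snd p \<in> {- pi<..pi}
      \<and> cmod (cis (fst p) - 1) < \<epsilon> \<and> cmod (cis (snd p) - 1) < \<epsilon>}"
    by (auto simp: angle_box_def)
  also have "\<dots> \<in> sets (borel \<Otimes>\<^sub>M borel)"
    unfolding borel_prod[symmetric] by measurable
  finally show ?thesis unfolding borel_prod .
qed

lemma angle_box_abs_less: "(t, s) \<in> angle_box \<epsilon> \<Longrightarrow> \<bar>t\<bar> < 2 * \<epsilon> \<and> \<bar>s\<bar> < 2 * \<epsilon>"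
  using chord_ge[of t] chord_ge[of s] by (simp add: angle_box_def abs_le_iff) linarith

lemma in_angle_box: "\<bar>t\<bar> < min \<epsilon> 1 \<Longrightarrow> \<bar>s\<bar> < min \<epsilon> 1 \<Longrightarrow> (t, s) \<in> angle_box \<epsilon>"
  using chord_le[of t] chord_le[of s] pi_gt3 by (auto simp: angle_box_def)

section \<open>Consequences of the hypotheses on p\<close>

context
  fixes a :: "nat \<Rightarrow> nat \<Rightarrow> nat \<Rightarrow> complex" and m n :: nat
  assumes deg: "has_degree a m n"
    and rif: "RIF a m n"
    and irr: "irreducible3 (P a m n)"
    and novert: "\<not> (\<exists>z1\<in>circ. \<exists>z2\<in>circ. \<forall>z3\<in>circ. Ptil a m n (z1, z2, z3) = 0)"
begin

lemma X1_nz: "ev (X1 a m n) (cis t) (cis s) \<noteq> 0"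
  by (rule X1_nonzero_on_torus[OF rif novert])

lemma ratio_le_1: "cmod (ratio a m n p) \<le> 1"
  using X2_le_X1[OF rif] by (simp add: ratio_def norm_divide divide_le_eq_1)

lemma rho_nonneg: "0 \<le> rho a m n t s"
  using ratio_le_1[of "(t, s)"] by (simp add: rho_ratio power_le_one)

lemma ratio_continuous: "continuous_on UNIV (ratio a m n)"
  unfolding ratio_def using X1_nz
  by (intro continuous_on_divide continuous_on_ev) (auto intro!: continuous_intros)

lemma AE_ratio_less_1: "AE p in lborel. cmod (ratio a m n p) < 1"
proof -
  have "X1 a m n \<noteq> 0" using X1_nz[of 0 0] by auto
  from jac_nonzero[OF deg rif irr this]
  show ?thesis
  proof (rule eventually_mono[OF AE_ev_cis_nonzero])
    fix p :: "real \<times> real" assume *: "ev (jac a m n) (cis (fst p)) (cis (snd p)) \<noteq> 0"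
    have "cmod (ratio a m n p) \<noteq> 1"
    proof
      assume "cmod (ratio a m n p) = 1"
      then have "cmod (ev (X2 a m n) (cis (fst p)) (cis (snd p))) = cmod (ev (X1 a m n) (cis (fst p)) (cis (snd p)))"
        using X1_nz by (simp add: ratio_def norm_divide divide_eq_1_iff)
      then show False using * by (simp add: jac_on_torus)
    qed
    then show "cmod (ratio a m n p) < 1" using ratio_le_1[of p] by simp
  qed
qed

lemma AE_rho_pos: "AE p in lborel. 0 < rho a m n (fst p) (snd p)"
  by (rule eventually_mono[OF AE_ratio_less_1]) (simp add: rho_ratio abs_square_less_1)

lemma smooth2_rho: "smooth2 (rho a m n)"
proof -
  have "smooth2 (\<lambda>t s. 1 - (cmod (ev (X2 a m n) (cis t) (cis s)))\<^sup>2 * inverse ((cmod (ev (X1 a m n) (cis t) (cis s)))\<^sup>2))"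
    using X1_nz
    by (intro smooth2_diff smooth2.const smooth2.mult smooth2.inverse smooth2_norm_sq smooth2c_ev) auto
  moreover have "rho a m n = (\<lambda>t s. 1 - (cmod (ev (X2 a m n) (cis t) (cis s)))\<^sup>2 * inverse ((cmod (ev (X1 a m n) (cis t) (cis s)))\<^sup>2))"
    by (simp add: fun_eq_iff rho_ratio ratio_def norm_divide power_divide field_simps)
  ultimately show ?thesis by simp
qed

lemma in_Lp_dphi3_iff:
  assumes q: "1 \<le> q"
  shows "in_Lp q (dphi3 a m n) (torus_box \<epsilon>) \<longleftrightarrow>
    (\<integral>\<^sup>+ p. ennreal (rho a m n (fst p) (snd p) powr (1 - q)) * indicator (angle_box \<epsilon>) p \<partial>lborel) < \<infinity>"
proof -
  define g where "g t = dphi3 a m n (cis (fst t), cis (fst (snd t)), cis (snd (snd t)))" for t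
  \<comment> \<open>A Borel formula that agrees with \<open>g\<close> wherever \<rho> > 0;
    completeness of Lebesgue measure then makes \<open>g\<close> measurable, whatever
    \<open>deriv\<close> returns on the null set.\<close>
  define h where "h t = ev (jac a m n) (cis (fst t)) (cis (fst (snd t)))
    / (P a m n (cis (fst t), cis (fst (snd t)), cis (snd (snd t))))\<^sup>2" for t :: "real \<times> real \<times> real"
  define A where "A = angles (torus_box \<epsilon>)"
  note cis_borel_measurable[measurable] angle_box_sets[measurable]
  have proj[measurable]: "(\<lambda>t::real \<times> real \<times> real. (fst t, fst (snd t))) \<in> borel_measurable borel"
    "(\<lambda>t::real \<times> real \<times> real. snd (snd t)) \<in> borel_measurable borel"
    by (auto intro!: borel_measurable_continuous_onI continuous_intros)
  have A: "A \<in> sets borel" unfolding A_def angles_torus_box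
  proof -
    have "{t \<in> space borel. (fst t, fst (snd t)) \<in> angle_box \<epsilon> \<and> snd (snd t) \<in> {- pi<..pi}}
      \<in> sets (borel :: (real \<times> real \<times> real) measure)" by measurable
    then show "{t. (fst t, fst (snd t)) \<in> angle_box \<epsilon> \<and> snd (snd t) \<in> {- pi<..pi}} \<in> sets borel" by simp
  qed
  have "{p \<in> space borel. cmod (ratio a m n p) \<ge> 1} \<in> sets borel"
    using borel_measurable_continuous_onI[OF ratio_continuous] by measurable
  then have N: "{p. cmod (ratio a m n p) \<ge> 1} \<in> sets borel" by simp
  have "AE t in (lborel :: (real \<times> real \<times> real) measure). (fst t, fst (snd t)) \<notin> {p. cmod (ratio a m n p) \<ge> 1}"
    by (rule AE_lborel_triple[OF N]) (use AE_ratio_less_1 in \<open>simp add: not_le\<close>)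
  then have ae: "AE t in lborel. g t = h t \<and> cmod (g t) = poisson (ratio a m n (fst t, fst (snd t))) (snd (snd t))"
  proof (rule eventually_mono)
    fix t :: "real \<times> real \<times> real"
    assume "(fst t, fst (snd t)) \<notin> {p. cmod (ratio a m n p) \<ge> 1}"
    then have "cmod (ratio a m n (fst t, fst (snd t))) < 1" by simp
    from dphi3_on_torus[OF X1_nz this, of "snd (snd t)"]
    show "g t = h t \<and> cmod (g t) = poisson (ratio a m n (fst t, fst (snd t))) (snd (snd t))"
      unfolding g_def h_def by (rule conjI)
  qed
  have hm: "h \<in> borel_measurable borel"
  proof -
    have "continuous_on UNIV (\<lambda>t::real \<times> real \<times> real. ev (jac a m n) (cis (fst t)) (cis (fst (snd t))))"
      by (intro continuous_on_ev continuous_intros)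
    moreover have "continuous_on UNIV (\<lambda>t::real \<times> real \<times> real. P a m n (cis (fst t), cis (fst (snd t)), cis (snd (snd t))))"
      unfolding P_ev prod.case by (intro continuous_intros continuous_on_ev)
    ultimately show ?thesis unfolding h_def
      by (intro borel_measurable_divide borel_measurable_power borel_measurable_continuous_onI)
  qed
  have "h \<in> borel_measurable lebesgue" using hm by (intro measurable_completion) simp
  moreover have "AE t in lebesgue. h t = g t"
    by (rule AE_completion, rule eventually_mono[OF ae]) (elim conjE, rule sym)
  ultimately have "g \<in> borel_measurable lebesgue" by (rule borel_measurable_AE)
  then have gm: "g \<in> borel_measurable (lebesgue_on A)" by (rule measurable_restrict_space1)
  have "(\<integral>\<^sup>+ t. ennreal (cmod (g t) powr q) \<partial>(lebesgue_on A))
      = (\<integral>\<^sup>+ t. ennreal (cmod (g t) powr q) * indicator A t \<partial>lebesgue)"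
    by (rule nn_integral_restrict_space) (use A in auto)
  also have "\<dots> = (\<integral>\<^sup>+ t. ennreal (cmod (g t) powr q) * indicator A t \<partial>lborel)"
    by (rule nn_integral_completion)
  also have "\<dots> = (\<integral>\<^sup>+ t. ennreal (poisson (ratio a m n (fst t, fst (snd t))) (snd (snd t)) powr q)
      * indicator {t. (fst t, fst (snd t)) \<in> angle_box \<epsilon> \<and> snd (snd t) \<in> {- pi<..pi}} t \<partial>lborel)"
    unfolding A_def angles_torus_box
  proof (rule nn_integral_cong_AE, rule eventually_mono[OF ae])
    fix t assume "g t = h t \<and> cmod (g t) = poisson (ratio a m n (fst t, fst (snd t))) (snd (snd t))"
    then have "cmod (g t) = poisson (ratio a m n (fst t, fst (snd t))) (snd (snd t))" by blast
    then show "ennreal (cmod (g t) powr q)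
        * indicator {t. (fst t, fst (snd t)) \<in> angle_box \<epsilon> \<and> snd (snd t) \<in> {- pi<..pi}} t
      = ennreal (poisson (ratio a m n (fst t, fst (snd t))) (snd (snd t)) powr q)
        * indicator {t. (fst t, fst (snd t)) \<in> angle_box \<epsilon> \<and> snd (snd t) \<in> {- pi<..pi}} t"
      by simp
  qed
  finally have integral: "(\<integral>\<^sup>+ t. ennreal (cmod (g t) powr q) \<partial>(lebesgue_on A)) = (\<integral>\<^sup>+ t. ennreal (poisson (ratio a m n (fst t, fst (snd t))) (snd (snd t)) powr q)
      * indicator {t. (fst t, fst (snd t)) \<in> angle_box \<epsilon> \<and> snd (snd t) \<in> {- pi<..pi}} t \<partial>lborel)" .
  have "in_Lp q (dphi3 a m n) (torus_box \<epsilon>) \<longleftrightarrow> g \<in> borel_measurable (lebesgue_on A)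
      \<and> (\<integral>\<^sup>+ t. ennreal (cmod (g t) powr q) \<partial>(lebesgue_on A)) < \<infinity>"
    unfolding in_Lp_def Let_def g_def A_def ..
  also have "\<dots> \<longleftrightarrow> (\<integral>\<^sup>+ t. ennreal (poisson (ratio a m n (fst t, fst (snd t))) (snd (snd t)) powr q)
      * indicator {t. (fst t, fst (snd t)) \<in> angle_box \<epsilon> \<and> snd (snd t) \<in> {- pi<..pi}} t \<partial>lborel) < \<infinity>"
    using gm unfolding integral by blast
  also have "\<dots> \<longleftrightarrow> (\<integral>\<^sup>+ p. ennreal ((1 - (cmod (ratio a m n p))\<^sup>2) powr (1 - q)) * indicator (angle_box \<epsilon>) p \<partial>lborel) < \<infinity>"
    by (rule poisson_Lp_iff[OF ratio_continuous AE_ratio_less_1 angle_box_sets q])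
  finally show ?thesis by (simp add: rho_ratio)
qed

end

subsection \<open>Integrability and the quadratic form\<close>

text \<open>For \<nu> \<ge> 1 the width is at most s, so x = O(s) and a cubic remainder is O(s^3) on
  the horn.\<close>

lemma horn_bounds:
  assumes "(s, x) \<in> horn \<beta> \<nu> \<delta>" "\<delta> \<le> 1" "1 \<le> \<nu>"
  shows "0 < s" "s < \<delta>" "\<bar>x - \<beta> * s\<bar> \<le> s powr \<nu>" "\<bar>x\<bar> \<le> (\<bar>\<beta>\<bar> + 1) * s"
proof -
  show s: "0 < s" "s < \<delta>" and le: "\<bar>x - \<beta> * s\<bar> \<le> s powr \<nu>"
    using assms(1) by (auto simp: horn_def)
  have "s powr \<nu> \<le> s powr 1" using s assms by (intro powr_mono') auto
  then have "\<bar>x - \<beta> * s\<bar> \<le> s" using le s by simp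
  moreover have "\<bar>x\<bar> \<le> \<bar>x - \<beta> * s\<bar> + \<bar>\<beta> * s\<bar>" by linarith
  moreover have "\<bar>\<beta> * s\<bar> = \<bar>\<beta>\<bar> * s" using s by (simp add: abs_mult)
  ultimately show "\<bar>x\<bar> \<le> (\<bar>\<beta>\<bar> + 1) * s" by (simp add: algebra_simps)
qed

text \<open>In the nondegenerate case \<open>f\<close> is comparable to \<open>t\<^sup>2 + s\<^sup>2\<close>; this is bounded below by
  \<open>2|t||s|\<close>, which reduces convergence to one-variable integrals.\<close>

lemma convergence_if_definite:
  fixes f :: "real \<Rightarrow> real \<Rightarrow> real"
  assumes K: "0 < K" and taylor: "\<And>t s. \<bar>t\<bar> \<le> 1 \<Longrightarrow> \<bar>s\<bar> \<le> 1 \<Longrightarrow>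
      \<bar>f t s - (A * t\<^sup>2 + B * t * s + C * s\<^sup>2)\<bar> \<le> K * (\<bar>t\<bar> + \<bar>s\<bar>) ^ 3"
    and AC: "0 < A + C" "B\<^sup>2 < 4 * A * C"
    and meas: "(\<lambda>p. f (fst p) (snd p)) \<in> borel_measurable borel"
  obtains \<epsilon> where "0 < \<epsilon>" "\<And>q. 1 \<le> q \<Longrightarrow> q < 2 \<Longrightarrow>
    (\<integral>\<^sup>+ p. ennreal (f (fst p) (snd p) powr (1 - q)) * indicator (angle_box \<epsilon>) p \<partial>lborel) < \<infinity>"
proof -
  define l where "l = (A * C - B\<^sup>2 / 4) / (A + C)"
  have l: "0 < l" using AC by (simp add: l_def)
  \<comment> \<open>With |t|, |s| < \<eta> the remainder is at most K * 2\<eta> * 2(t^2 + s^2); this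
    choice keeps it within half of l (t^2 + s^2).\<close>
  define \<eta> where "\<eta> = min 1 (l / (8 * K))"
  have \<eta>: "0 < \<eta>" "\<eta> \<le> 1" "4 * K * \<eta> \<le> l / 2"
  proof -
    show "0 < \<eta>" "\<eta> \<le> 1" using l K by (auto simp: \<eta>_def)
    have "\<eta> \<le> l / (8 * K)" by (simp add: \<eta>_def)
    then show "4 * K * \<eta> \<le> l / 2" using K by (simp add: field_simps)
  qed
  \<comment> \<open>Halving \<eta> pays for the factor 2 between chord and angle.\<close>
  have box: "\<bar>t\<bar> < \<eta> \<and> \<bar>s\<bar> < \<eta>" if "(t, s) \<in> angle_box (\<eta> / 2)" for t s
    using angle_box_abs_less[OF that] by simp
  have lower: "l * (\<bar>t\<bar> * \<bar>s\<bar>) \<le> f t s" if "(t, s) \<in> angle_box (\<eta> / 2)" for t s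
  proof -
    have ts: "\<bar>t\<bar> < \<eta>" "\<bar>s\<bar> < \<eta>" using box[OF that] by auto
    define R where "R = t\<^sup>2 + s\<^sup>2"
    have R: "2 * (\<bar>t\<bar> * \<bar>s\<bar>) \<le> R" "0 \<le> R"
      using sum_squares_bound[of "\<bar>t\<bar>" "\<bar>s\<bar>"] by (auto simp: R_def mult_ac)
    have "(\<bar>t\<bar> + \<bar>s\<bar>)\<^sup>2 = R + 2 * (\<bar>t\<bar> * \<bar>s\<bar>)"
      by (simp add: R_def power2_eq_square algebra_simps)
    then have sq: "(\<bar>t\<bar> + \<bar>s\<bar>)\<^sup>2 \<le> 2 * R" using R by simp
    have "(\<bar>t\<bar> + \<bar>s\<bar>) ^ 3 = (\<bar>t\<bar> + \<bar>s\<bar>) * (\<bar>t\<bar> + \<bar>s\<bar>)\<^sup>2"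
      by (simp add: power2_eq_square power3_eq_cube)
    also have "\<dots> \<le> (2 * \<eta>) * (2 * R)" using ts sq \<eta> by (intro mult_mono) auto
    finally have "K * (\<bar>t\<bar> + \<bar>s\<bar>) ^ 3 \<le> K * ((2 * \<eta>) * (2 * R))" using K by simp
    also have "\<dots> = 4 * K * \<eta> * R" by simp
    also have "\<dots> \<le> l / 2 * R" using \<eta>(3) R by (intro mult_right_mono) auto
    finally have "K * (\<bar>t\<bar> + \<bar>s\<bar>) ^ 3 \<le> l / 2 * R" .
    moreover have "l * R \<le> A * t\<^sup>2 + B * t * s + C * s\<^sup>2"
      unfolding l_def R_def by (rule quadratic_form_ge[OF AC(1)])
    moreover have "\<bar>f t s - (A * t\<^sup>2 + B * t * s + C * s\<^sup>2)\<bar> \<le> K * (\<bar>t\<bar> + \<bar>s\<bar>) ^ 3"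
      by (rule taylor) (use ts \<eta> in auto)
    moreover have "l * (2 * (\<bar>t\<bar> * \<bar>s\<bar>)) \<le> l * R" using l R by simp
    ultimately show ?thesis by (simp add: abs_le_iff)
  qed
  show ?thesis
  proof
    show "0 < \<eta> / 2" using \<eta> by simp
    fix q :: real assume q: "1 \<le> q" "q < 2"
    show "(\<integral>\<^sup>+ p. ennreal (f (fst p) (snd p) powr (1 - q)) * indicator (angle_box (\<eta> / 2)) p \<partial>lborel) < \<infinity>"
    proof (rule powr_integral_converges[OF l q])
      show "angle_box (\<eta> / 2) \<subseteq> {- 1..1} \<times> {- 1..1}"
        using box \<eta> by (fastforce simp: abs_less_iff)
    qed (use lower meas angle_box_sets in auto)
  qed
qed

text \<open>Any form with cubic remainder is O(s^2) on the sector 0 < x < s near the origin, so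
  \<mu> = 2, and the condition 1 \<le> 2(q - 3/2) is q \<ge> 2.\<close>

lemma divergence_if_exponent_ge_2:
  fixes f :: "real \<Rightarrow> real \<Rightarrow> real"
  assumes pos: "AE p in lborel. 0 < f (fst p) (snd p)" and \<epsilon>: "0 < \<epsilon>" and q: "2 \<le> q"
    and K: "0 < K" and taylor: "\<And>t s. \<bar>t\<bar> \<le> 1 \<Longrightarrow> \<bar>s\<bar> \<le> 1 \<Longrightarrow>
      \<bar>f t s - (A * t\<^sup>2 + B * t * s + C * s\<^sup>2)\<bar> \<le> K * (\<bar>t\<bar> + \<bar>s\<bar>) ^ 3"
  shows "(\<integral>\<^sup>+ p. ennreal (f (fst p) (snd p) powr (1 - q)) * indicator (angle_box \<epsilon>) p \<partial>lborel) = \<infinity>"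
proof (rule powr_integral_diverges[where \<sigma> = "\<lambda>p. p" and \<mu> = 2 and \<beta> = 0 and \<delta> = "min \<epsilon> 1"
      and K = "\<bar>A\<bar> + \<bar>B\<bar> + \<bar>C\<bar> + 8 * K"])
  fix s x :: real assume "(s, x) \<in> horn 0 (2 / 2) (min \<epsilon> 1)"
  from horn_bounds[OF this] have s: "0 < s" "s < min \<epsilon> 1" and x: "\<bar>x\<bar> \<le> s" by auto
  have "\<bar>A * s\<^sup>2\<bar> \<le> \<bar>A\<bar> * s\<^sup>2" by (simp add: abs_mult)
  moreover have "\<bar>B * s * x\<bar> \<le> \<bar>B\<bar> * s\<^sup>2"
    using s x by (simp add: abs_mult power2_eq_square mult.assoc mult_left_mono)
  moreover have "\<bar>C * x\<^sup>2\<bar> \<le> \<bar>C\<bar> * s\<^sup>2"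
    using s x by (simp add: abs_mult mult_left_mono abs_le_square_iff[symmetric])
  moreover have "K * (\<bar>s\<bar> + \<bar>x\<bar>) ^ 3 \<le> 8 * K * s\<^sup>2"
  proof -
    have "(\<bar>s\<bar> + \<bar>x\<bar>) ^ 3 \<le> (2 * s) ^ 3" using s x by (intro power_mono) auto
    also have "\<dots> = 8 * (s * s\<^sup>2)" by (simp add: power2_eq_square power3_eq_cube)
    also have "\<dots> \<le> 8 * (1 * s\<^sup>2)" using s by (intro mult_left_mono mult_right_mono) auto
    finally show ?thesis using K by simp
  qed
  moreover have "\<bar>f s x - (A * s\<^sup>2 + B * s * x + C * x\<^sup>2)\<bar> \<le> K * (\<bar>s\<bar> + \<bar>x\<bar>) ^ 3"
    by (rule taylor) (use s x in auto)
  ultimately have "f s x \<le> \<bar>A\<bar> * s\<^sup>2 + \<bar>B\<bar> * s\<^sup>2 + \<bar>C\<bar> * s\<^sup>2 + 8 * K * s\<^sup>2"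
    by linarith
  also have "\<dots> = (\<bar>A\<bar> + \<bar>B\<bar> + \<bar>C\<bar> + 8 * K) * s powr 2"
    using s by (simp add: algebra_simps powr_numeral)
  finally show "(s, x) \<in> angle_box \<epsilon> \<and> f (fst (s, x)) (snd (s, x)) \<le> (\<bar>A\<bar> + \<bar>B\<bar> + \<bar>C\<bar> + 8 * K) * s powr 2"
    using in_angle_box[of s \<epsilon> x] s x by simp
qed (use pos q K \<epsilon> in auto)

lemma divergence_if_degenerate:
  fixes f :: "real \<Rightarrow> real \<Rightarrow> real"
  assumes pos: "AE p in lborel. 0 < f (fst p) (snd p)" and \<epsilon>: "0 < \<epsilon>"
    and K: "0 < K" and taylor: "\<And>t s. \<bar>t\<bar> \<le> 1 \<Longrightarrow> \<bar>s\<bar> \<le> 1 \<Longrightarrow>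
      \<bar>f t s - (A * t\<^sup>2 + B * t * s + C * s\<^sup>2)\<bar> \<le> K * (\<bar>t\<bar> + \<bar>s\<bar>) ^ 3"
    and AC: "0 \<le> A" "0 \<le> C" "B\<^sup>2 = 4 * A * C"
  shows "(\<integral>\<^sup>+ p. ennreal (f (fst p) (snd p) powr (1 - 11 / 6)) * indicator (angle_box \<epsilon>) p \<partial>lborel) = \<infinity>"
proof -
  have square: "x\<^sup>2 \<le> s powr 3" if "\<bar>x\<bar> \<le> s powr (3 / 2)" for x s :: real
  proof -
    have "x\<^sup>2 \<le> (s powr (3 / 2))\<^sup>2" using that by (simp add: abs_le_square_iff[symmetric])
    also have "\<dots> = s powr 3" by (simp add: power2_eq_square flip: powr_add)
    finally show ?thesis .
  qed
  \<comment> \<open>The null line is t = \<beta> s when A is nonzero; it is parametrised by the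
    second angle, hence the swap below. For A = 0 also B = 0, the form is C s^2 and a horn along the
    first axis is used.\<close>
  define \<beta> where "\<beta> = (if A = 0 then 0 else - B / (2 * A))"
  \<comment> \<open>On the horn |x| is at most (|\<beta>| + 1) s; dividing by this factor keeps the
    horn inside the box.\<close>
  define \<delta> where "\<delta> = min \<epsilon> 1 / (\<bar>\<beta>\<bar> + 1)"
  \<comment> \<open>One of A and C is the coefficient of the remaining square; the last term bounds
    the cubic remainder, as |s| + |x| \<le> (|\<beta>| + 2) s.\<close>
  define L where "L = A + C + K * (\<bar>\<beta>\<bar> + 2) ^ 3"
  have \<delta>: "0 < \<delta>" "\<delta> \<le> 1" using \<epsilon> by (auto simp: \<delta>_def divide_le_eq min_le_iff_disj)
  have L: "0 < L" using AC K by (auto simp: L_def intro!: add_nonneg_pos mult_pos_pos)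
  have cubic: "K * (\<bar>s\<bar> + \<bar>x\<bar>) ^ 3 \<le> K * (\<bar>\<beta>\<bar> + 2) ^ 3 * s powr 3"
    and box: "\<bar>s\<bar> < min \<epsilon> 1" "\<bar>x\<bar> < min \<epsilon> 1"
    and width: "(x - \<beta> * s)\<^sup>2 \<le> s powr 3"
    if h: "(s, x) \<in> horn \<beta> (3 / 2) \<delta>" for s x
  proof -
    note hb = horn_bounds[OF h \<delta>(2), simplified]
    have "\<bar>s\<bar> + \<bar>x\<bar> \<le> (\<bar>\<beta>\<bar> + 2) * s" using hb by (simp add: algebra_simps)
    then have "(\<bar>s\<bar> + \<bar>x\<bar>) ^ 3 \<le> ((\<bar>\<beta>\<bar> + 2) * s) ^ 3" by (intro power_mono) auto
    also have "\<dots> = (\<bar>\<beta>\<bar> + 2) ^ 3 * s powr 3"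
      using hb by (simp add: power_mult_distrib powr_numeral)
    finally show "K * (\<bar>s\<bar> + \<bar>x\<bar>) ^ 3 \<le> K * (\<bar>\<beta>\<bar> + 2) ^ 3 * s powr 3"
      using K by (simp add: mult.assoc)
    have lt: "(\<bar>\<beta>\<bar> + 1) * s < min \<epsilon> 1"
    proof -
      have "(\<bar>\<beta>\<bar> + 1) * s < (\<bar>\<beta>\<bar> + 1) * \<delta>" using hb by (intro mult_strict_left_mono) auto
      also have "\<dots> = min \<epsilon> 1" by (simp add: \<delta>_def)
      finally show ?thesis .
    qed
    show "\<bar>x\<bar> < min \<epsilon> 1" using lt hb(4) by linarith
    have "0 \<le> \<bar>\<beta>\<bar> * s" using hb by simp
    then have "s \<le> (\<bar>\<beta>\<bar> + 1) * s" by (simp add: algebra_simps)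
    then show "\<bar>s\<bar> < min \<epsilon> 1" using lt hb(1) by linarith
    show "(x - \<beta> * s)\<^sup>2 \<le> s powr 3" using hb by (intro square) simp
  qed
  have q: "(1::real) \<le> 11 / 6" "1 \<le> 3 * (11 / 6 - 3 / 2 :: real)" by auto
  show ?thesis
  proof (cases "A = 0")
    case True
    then have B: "B = 0" and \<beta>: "\<beta> = 0" using AC by (auto simp: \<beta>_def)
    show ?thesis
    proof (rule powr_integral_diverges[OF pos L \<delta> q, where \<sigma> = "\<lambda>p. p" and \<beta> = \<beta>])
      fix s x assume h: "(s, x) \<in> horn \<beta> (3 / 2) \<delta>"
      have "\<bar>f s x - (A * s\<^sup>2 + B * s * x + C * x\<^sup>2)\<bar> \<le> K * (\<bar>s\<bar> + \<bar>x\<bar>) ^ 3"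
        by (rule taylor) (use box[OF h] in auto)
      then have "f s x \<le> C * x\<^sup>2 + K * (\<bar>s\<bar> + \<bar>x\<bar>) ^ 3" using True B by (simp add: abs_le_iff)
      also have "\<dots> \<le> C * s powr 3 + K * (\<bar>\<beta>\<bar> + 2) ^ 3 * s powr 3"
        using width[OF h] \<beta> AC cubic[OF h] by (intro add_mono mult_left_mono) auto
      also have "\<dots> = L * s powr 3" using True by (simp add: L_def algebra_simps)
      finally show "(s, x) \<in> angle_box \<epsilon> \<and> f (fst (s, x)) (snd (s, x)) \<le> L * s powr 3"
        using in_angle_box[of s \<epsilon> x] box[OF h] by simp
    qed simp
  next
    case False
    then have A: "0 < A" using AC by simp
    show ?thesis
    proof (rule powr_integral_diverges[OF pos L \<delta> q, where \<sigma> = prod.swap and \<beta> = \<beta>])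
      fix s x assume h: "(s, x) \<in> horn \<beta> (3 / 2) \<delta>"
      have C: "C = B\<^sup>2 / (4 * A)" using AC A by simp
      have sq: "A * x\<^sup>2 + B * x * s + C * s\<^sup>2 = A * (x - \<beta> * s)\<^sup>2"
        using A by (simp add: C \<beta>_def power2_eq_square field_simps)
      have "\<bar>f x s - (A * x\<^sup>2 + B * x * s + C * s\<^sup>2)\<bar> \<le> K * (\<bar>x\<bar> + \<bar>s\<bar>) ^ 3"
        by (rule taylor) (use box[OF h] in auto)
      then have "f x s \<le> A * (x - \<beta> * s)\<^sup>2 + K * (\<bar>s\<bar> + \<bar>x\<bar>) ^ 3"
        unfolding sq by (simp add: abs_le_iff add.commute)
      also have "\<dots> \<le> A * s powr 3 + K * (\<bar>\<beta>\<bar> + 2) ^ 3 * s powr 3"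
        using width[OF h] AC cubic[OF h] by (intro add_mono mult_left_mono) auto
      also have "\<dots> \<le> L * s powr 3" using AC by (simp add: L_def algebra_simps)
      finally show "prod.swap (s, x) \<in> angle_box \<epsilon>
          \<and> f (fst (prod.swap (s, x))) (snd (prod.swap (s, x))) \<le> L * s powr 3"
        using in_angle_box[of x \<epsilon> s] box[OF h] by simp
    qed simp
  qed
qed

section \<open>The two cases of the discriminant\<close>

theorem theorem3p12:
  fixes a :: "nat \<Rightarrow> nat \<Rightarrow> nat \<Rightarrow> complex" and m n :: nat
  assumes deg: "has_degree a m n"
    and rif: "RIF a m n"
    and irr: "irreducible3 (P a m n)"
    and novert: "\<not> (\<exists>z1\<in>circ. \<exists>z2\<in>circ. \<forall>z3\<in>circ. Ptil a m n (z1, z2, z3) = 0)"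
    and sing: "P a m n (1, 1, 1) = 0"
  shows "(c11 a m n \<noteq> 2 * sqrt (c02 a m n * c20 a m n) \<and>
          c11 a m n \<noteq> - 2 * sqrt (c02 a m n * c20 a m n) \<longrightarrow>
          (\<exists>V. nbhd_T2 V \<and> (\<forall>q::real. 1 \<le> q \<longrightarrow> (in_Lp q (dphi3 a m n) V \<longleftrightarrow> q < 2))))
       \<and> (c11 a m n = 2 * sqrt (c02 a m n * c20 a m n) \<or>
          c11 a m n = - 2 * sqrt (c02 a m n * c20 a m n) \<longrightarrow>
          (\<exists>V q. nbhd_T2 V \<and> 1 \<le> q \<and> q < 2 \<and> \<not> in_Lp q (dphi3 a m n) V))"
proof -
  note facts = deg rif irr novert
  define A B C where "A = c20 a m n" and "B = c11 a m n" and "C = c02 a m n"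
  have zero: "rho a m n 0 0 = 0"
  proof -
    \<comment> \<open>The singularity makes |p_2/p_1| = 1 at (1,1).\<close>
    have "ev (X2 a m n) 1 1 = - ev (X1 a m n) 1 1"
      using sing by (simp add: P_ev add_eq_0_iff)
    then show ?thesis
      using X1_nz[OF facts, of 0 0] by (simp add: rho_ratio ratio_def norm_divide)
  qed
  note expansion = smooth2_quadratic_at_min[OF smooth2_rho[OF facts] rho_nonneg[OF facts] zero,
      folded c20_def c11_def c02_def, folded A_def B_def C_def]
  obtain K where K: "0 < K" and taylor: "\<And>t s. \<bar>t\<bar> \<le> 1 \<Longrightarrow> \<bar>s\<bar> \<le> 1 \<Longrightarrow>
    \<bar>rho a m n t s - (A * t\<^sup>2 + B * t * s + C * s\<^sup>2)\<bar> \<le> K * (\<bar>t\<bar> + \<bar>s\<bar>) ^ 3"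
    by (rule expansion) (rule that)
  have nonneg: "0 \<le> A * t\<^sup>2 + B * t * s + C * s\<^sup>2" for t s
    by (rule quadratic_form_nonneg_if_cubic_remainder[OF rho_nonneg[OF facts] taylor])
  note AC = discriminant_le_0_if_nonneg[OF nonneg]
  note pos = AE_rho_pos[OF facts]
  have meas: "(\<lambda>p. rho a m n (fst p) (snd p)) \<in> borel_measurable borel"
    by (rule borel_measurable_continuous_onI[OF smooth2_continuous[OF smooth2_rho[OF facts]]])
  \<comment> \<open>The two exceptional values of \<open>c11\<close> are exactly those where the
    discriminant vanishes; A C \<ge> 0 lets the square root be squared away.\<close>
  have abs_eq: "B\<^sup>2 = 4 * A * C \<longleftrightarrow> B = 2 * sqrt (C * A) \<or> B = - 2 * sqrt (C * A)"
  proof -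
    have eq: "(2 * sqrt (C * A))\<^sup>2 = 4 * A * C" using AC by (simp add: power_mult_distrib)
    show ?thesis
      using power2_eq_iff[of B "2 * sqrt (C * A)"] unfolding eq by (simp only: mult_minus_left)
  qed
  have "\<exists>V. nbhd_T2 V \<and> (\<forall>q::real. 1 \<le> q \<longrightarrow> (in_Lp q (dphi3 a m n) V \<longleftrightarrow> q < 2))"
    if "B\<^sup>2 \<noteq> 4 * A * C"
  proof -
    have lt: "B\<^sup>2 < 4 * A * C" using that AC by simp
    then have "A \<noteq> 0" by auto
    then have trace: "0 < A + C" using AC by simp
    obtain \<epsilon> where \<epsilon>: "0 < \<epsilon>" and conv: "\<And>q. 1 \<le> q \<Longrightarrow> q < 2 \<Longrightarrow>
      (\<integral>\<^sup>+ p. ennreal (rho a m n (fst p) (snd p) powr (1 - q)) * indicator (angle_box \<epsilon>) p \<partial>lborel) < \<infinity>"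
      by (rule convergence_if_definite[OF K taylor trace lt meas]) (assumption+, rule that)
    have "in_Lp q (dphi3 a m n) (torus_box \<epsilon>) \<longleftrightarrow> q < 2" if q: "1 \<le> q" for q
    proof (cases "q < 2")
      case True
      then show ?thesis using conv q by (simp add: in_Lp_dphi3_iff[OF facts q])
    next
      case False
      then have "2 \<le> q" by simp
      from divergence_if_exponent_ge_2[OF pos \<epsilon> this K taylor]
      show ?thesis using False by (simp add: in_Lp_dphi3_iff[OF facts q])
    qed
    then show ?thesis using nbhd_T2_torus_box[OF \<epsilon>] by blast
  qed
  moreover have "\<exists>V q. nbhd_T2 V \<and> 1 \<le> q \<and> q < 2 \<and> \<not> in_Lp q (dphi3 a m n) V"
    if "B\<^sup>2 = 4 * A * C"
  proof (intro exI conjI)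
    \<comment> \<open>The degenerate integral diverges on every box, so the radius 1 is
      arbitrary.\<close>
    show "nbhd_T2 (torus_box 1)" by (rule nbhd_T2_torus_box) simp
    show "\<not> in_Lp (11 / 6) (dphi3 a m n) (torus_box 1)"
    proof -
      have "(\<integral>\<^sup>+ p. ennreal (rho a m n (fst p) (snd p) powr (1 - 11 / 6)) * indicator (angle_box 1) p \<partial>lborel) = \<infinity>"
        by (rule divergence_if_degenerate[OF pos _ K taylor AC(1,2) that]) simp_all
      then show ?thesis by (subst in_Lp_dphi3_iff[OF facts]) simp_all
    qed
  qed simp_all
  ultimately show ?thesis
    unfolding A_def[symmetric] B_def[symmetric] C_def[symmetric] using abs_eq by argo
qed

end
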